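(* Let $(\rho_{\sigma,\tau})_{0\le\sigma\le\tau}$ be a time consistent normalized dynamic risk measure on $(\Omega,\mathcal F_\infty,(\mathcal F_t)_{t\in\mathbb R^+},P)$ that is continuous from above. Let $T$ be a stopping time. Assume that there is in $\mathcal M^0_{0,T}$ a probability measure $Q$ equivalent to $P$. Let $X\in L^\infty(\mathcal F_T)$. Then there is a c\`adl\`ag $Q$-supermartingale process $Y$ such that for every finite stopping time $\sigma\le T$, $\rho_{\sigma,T}(X)=Y_\sigma$ in $L^\infty(\Omega,\mathcal F_\sigma,P)$.
   Context: Setting: $(\Omega,\mathcal F_\infty,(\mathcal F_t)_{t\in\mathbb R^+},P)$ is a filtered probability space; the filtration is right continuous and $\mathcal F_0$ is the $\sigma$-algebra generated by the $P$-null sets of $\mathcal F_\infty$. Stopping times may take the value $\infty$; $\mathcal F_\tau=\{A\in\mathcal F_\infty: A\cap\{\tau\le t\}\in\mathcal F_t\ \forall t\in\mathbb R^+\}$. Functions are identified with their classes in $L^\infty(\mathcal F_\tau)=L^\infty(\Omega,\mathcal F_\tau,P)$. Dynamic risk measure: a family of maps $\rho_{\sigma,\tau}:L^\infty(\mathcal F_\tau)\to L^\infty(\mathcal F_\sigma)$, indexed by pairs of stopping times $0\le\sigma\le\tau$, each satisfying ($P$-a.s.): monotonicity ($X\le Y\Rightarrow\rho_{\sigma,\tau}(X)\ge\rho_{\sigma,\tau}(Y)$); translation invariance ($\rho_{\sigma,\tau}(X+Z)=\rho_{\sigma,\tau}(X)-Z$ for $Z\in L^\infty(\mathcal F_\sigma)$);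 convexity ($\rho_{\sigma,\tau}(\lambda X+(1-\lambda)Y)\le\lambda\rho_{\sigma,\tau}(X)+(1-\lambda)\rho_{\sigma,\tau}(Y)$ for $\lambda\in[0,1]$). Normalized: $\rho_{\sigma,\tau}(0)=0$ for all $\sigma\le\tau$. Continuous from above: for all $\sigma\le\tau$ and every decreasing sequence $X_n$ in $L^\infty(\mathcal F_\tau)$ with a.s. limit $X\in L^\infty(\mathcal F_\tau)$, $\rho_{\sigma,\tau}(X_n)$ increases to $\rho_{\sigma,\tau}(X)$ a.s. Time consistent: for all stopping times $0\le\nu\le\sigma\le\tau$ and $X\in L^\infty(\mathcal F_\tau)$, $\rho_{\nu,\sigma}(-\rho_{\sigma,\tau}(X))=\rho_{\nu,\tau}(X)$. Minimal penalty: for a probability measure $Q\ll P$, $$\alpha^m_{\sigma,\tau}(Q)=Q\text{-}\operatorname{ess\,sup}_{X\in L^\infty(\Omega,\mathcal F_\tau,P)}\big(E_Q(-X\mid\mathcal F_\sigma)-\rho_{\sigma,\tau}(X)\big).$$ $\mathcal M^0_{0,T}$ is the set of probability measures $Q$ on $(\Omega,\mathcal F_\infty)$ with $Q\ll P$ and $\alpha^m_{0,T}(Q)=0$. A $Q$-supermartingale is a supermartingale under $Q$ for the filtration $(\mathcal F_t)$. *)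

theory Defs
  imports "HOL-Probability.Probability"
begin

text \<open>
  The filtration is indexed by \<open>[0,\<infinity>]\<close> (type \<^typ>\<open>ennreal\<close>), where \<open>F \<infinity>\<close> is the
  \<sigma>-algebra \<open>\<F>\<^sub>\<infinity>\<close> of the probability space.  For this index type the library's
  \<^const>\<open>stopping_time\<close> is the usual notion of a stopping time with values in \<open>[0,\<infinity>]\<close> (its
  clause for \<open>t = \<infinity>\<close> is vacuous), and the clause for \<open>t = \<infinity>\<close> of
  \<^const>\<open>filtration.pre_sigma\<close> is precisely \<open>A \<in> \<F>\<^sub>\<infinity>\<close>.
\<close>

locale filtered_prob_space =
  prob_space M + filtration "space M" F
  for M :: "'a measure" and F :: "ennreal \<Rightarrow> 'a measure" +
  assumes sets_F_infinity: "sets (F \<infinity>) = sets M"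
    and right_continuous: "\<And>t. t < \<infinity> \<Longrightarrow> sets (F t) = (\<Inter>s\<in>{t<..}. sets (F s))"
    and sets_F_0: "sets (F 0) = sigma_sets (space M) (null_sets M)"

abbreviation stopped_algebra ::
    "'a measure \<Rightarrow> (ennreal \<Rightarrow> 'a measure) \<Rightarrow> ('a \<Rightarrow> ennreal) \<Rightarrow> 'a measure" where
  "stopped_algebra M F \<tau> \<equiv> filtration.pre_sigma (space M) F \<tau>"

text \<open>
  Elements of \<open>L\<^sup>\<infinity>\<close> are represented by functions; equalities and inequalities in \<open>L\<^sup>\<infinity>\<close>
  are stated almost everywhere with respect to \<open>M\<close>.  The measure carried by \<open>G\<close> is irrelevant.
\<close>

definition Linfty :: "'a measure \<Rightarrow> 'a measure \<Rightarrow> ('a \<Rightarrow> real) set" where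
  "Linfty M G = {X \<in> borel_measurable G. \<exists>c. AE \<omega> in M. \<bar>X \<omega>\<bar> \<le> c}"

definition ordered_stopping_times ::
    "'a measure \<Rightarrow> (ennreal \<Rightarrow> 'a measure) \<Rightarrow> ('a \<Rightarrow> ennreal) \<Rightarrow> ('a \<Rightarrow> ennreal) \<Rightarrow> bool" where
  "ordered_stopping_times M F \<sigma> \<tau> \<longleftrightarrow>
     stopping_time F \<sigma> \<and> stopping_time F \<tau> \<and> (\<forall>\<omega>\<in>space M. \<sigma> \<omega> \<le> \<tau> \<omega>)"

type_synonym 'a risk_family =
  "('a \<Rightarrow> ennreal) \<Rightarrow> ('a \<Rightarrow> ennreal) \<Rightarrow> ('a \<Rightarrow> real) \<Rightarrow> 'a \<Rightarrow> real"

text \<open>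
  A family \<open>\<rho> \<sigma> \<tau>\<close> acting on representatives.  Only its values for stopping times \<open>\<sigma> \<le> \<tau>\<close>
  and \<open>X \<in> L\<^sup>\<infinity>(\<F>\<^sub>\<tau>)\<close> matter.  Monotonicity, being stated almost everywhere, also says
  that \<open>\<rho> \<sigma> \<tau>\<close> respects almost everywhere equality, hence acts on classes.
\<close>

definition dynamic_risk_measure ::
    "'a measure \<Rightarrow> (ennreal \<Rightarrow> 'a measure) \<Rightarrow> 'a risk_family \<Rightarrow> bool" where
  "dynamic_risk_measure M F \<rho> \<longleftrightarrow>
     (\<forall>\<sigma> \<tau>. ordered_stopping_times M F \<sigma> \<tau> \<longrightarrow>
        (\<forall>X\<in>Linfty M (stopped_algebra M F \<tau>).
           \<rho> \<sigma> \<tau> X \<in> Linfty M (stopped_algebra M F \<sigma>)) \<and>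
        (\<forall>X\<in>Linfty M (stopped_algebra M F \<tau>). \<forall>Y\<in>Linfty M (stopped_algebra M F \<tau>).
           (AE \<omega> in M. X \<omega> \<le> Y \<omega>) \<longrightarrow> (AE \<omega> in M. \<rho> \<sigma> \<tau> X \<omega> \<ge> \<rho> \<sigma> \<tau> Y \<omega>)) \<and>
        (\<forall>X\<in>Linfty M (stopped_algebra M F \<tau>). \<forall>Z\<in>Linfty M (stopped_algebra M F \<sigma>).
           AE \<omega> in M. \<rho> \<sigma> \<tau> (\<lambda>\<omega>'. X \<omega>' + Z \<omega>') \<omega> = \<rho> \<sigma> \<tau> X \<omega> - Z \<omega>) \<and>
        (\<forall>X\<in>Linfty M (stopped_algebra M F \<tau>). \<forall>Y\<in>Linfty M (stopped_algebra M F \<tau>).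
           \<forall>l\<in>{0..1}. AE \<omega> in M. \<rho> \<sigma> \<tau> (\<lambda>\<omega>'. l * X \<omega>' + (1 - l) * Y \<omega>') \<omega>
                                  \<le> l * \<rho> \<sigma> \<tau> X \<omega> + (1 - l) * \<rho> \<sigma> \<tau> Y \<omega>))"

definition normalized ::
    "'a measure \<Rightarrow> (ennreal \<Rightarrow> 'a measure) \<Rightarrow> 'a risk_family \<Rightarrow> bool" where
  "normalized M F \<rho> \<longleftrightarrow>
     (\<forall>\<sigma> \<tau>. ordered_stopping_times M F \<sigma> \<tau> \<longrightarrow> (AE \<omega> in M. \<rho> \<sigma> \<tau> (\<lambda>_. 0) \<omega> = 0))"

definition continuous_from_above ::
    "'a measure \<Rightarrow> (ennreal \<Rightarrow> 'a measure) \<Rightarrow> 'a risk_family \<Rightarrow> bool" where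
  "continuous_from_above M F \<rho> \<longleftrightarrow>
     (\<forall>\<sigma> \<tau> X Xs. ordered_stopping_times M F \<sigma> \<tau> \<longrightarrow>
        X \<in> Linfty M (stopped_algebra M F \<tau>) \<longrightarrow>
        (\<forall>n::nat. Xs n \<in> Linfty M (stopped_algebra M F \<tau>)) \<longrightarrow>
        (AE \<omega> in M. decseq (\<lambda>n. Xs n \<omega>) \<and> (\<lambda>n. Xs n \<omega>) \<longlonglongrightarrow> X \<omega>) \<longrightarrow>
        (AE \<omega> in M. incseq (\<lambda>n. \<rho> \<sigma> \<tau> (Xs n) \<omega>) \<and> (\<lambda>n. \<rho> \<sigma> \<tau> (Xs n) \<omega>) \<longlonglongrightarrow> \<rho> \<sigma> \<tau> X \<omega>))"

definition time_consistent ::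
    "'a measure \<Rightarrow> (ennreal \<Rightarrow> 'a measure) \<Rightarrow> 'a risk_family \<Rightarrow> bool" where
  "time_consistent M F \<rho> \<longleftrightarrow>
     (\<forall>\<nu> \<sigma> \<tau>. ordered_stopping_times M F \<nu> \<sigma> \<longrightarrow> ordered_stopping_times M F \<sigma> \<tau> \<longrightarrow>
        (\<forall>X\<in>Linfty M (stopped_algebra M F \<tau>).
           AE \<omega> in M. \<rho> \<nu> \<sigma> (\<lambda>\<omega>'. - \<rho> \<sigma> \<tau> X \<omega>') \<omega> = \<rho> \<nu> \<tau> X \<omega>))"

text \<open>
  The essential supremum of a family \<open>S\<close> of random variables is the least random variable, up to
  \<open>Q\<close>-null sets, dominating every member of \<open>S\<close> almost everywhere.  It is unique only up to
  null sets, so it is given as a relation: \<open>Z\<close> is a version of the essential supremum.  (The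
  library's \<^const>\<open>esssup\<close> is the essential supremum of a single function.)
\<close>

definition is_ess_sup :: "'a measure \<Rightarrow> ('a \<Rightarrow> ereal) set \<Rightarrow> ('a \<Rightarrow> ereal) \<Rightarrow> bool" where
  "is_ess_sup Q S Z \<longleftrightarrow>
     Z \<in> borel_measurable Q \<and>
     (\<forall>f\<in>S. AE \<omega> in Q. f \<omega> \<le> Z \<omega>) \<and>
     (\<forall>Z'\<in>borel_measurable Q. (\<forall>f\<in>S. AE \<omega> in Q. f \<omega> \<le> Z' \<omega>) \<longrightarrow> (AE \<omega> in Q. Z \<omega> \<le> Z' \<omega>))"

text \<open>\<open>is_min_penalty M F \<rho> \<sigma> \<tau> Q \<alpha>\<close>: the function \<open>\<alpha>\<close> is a version of
  \<open>\<alpha>\<^sup>m\<^bsub>\<sigma>,\<tau>\<^esub>(Q)\<close>.\<close>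

definition is_min_penalty ::
    "'a measure \<Rightarrow> (ennreal \<Rightarrow> 'a measure) \<Rightarrow> 'a risk_family \<Rightarrow>
     ('a \<Rightarrow> ennreal) \<Rightarrow> ('a \<Rightarrow> ennreal) \<Rightarrow> 'a measure \<Rightarrow> ('a \<Rightarrow> ereal) \<Rightarrow> bool" where
  "is_min_penalty M F \<rho> \<sigma> \<tau> Q \<alpha> \<longleftrightarrow>
     is_ess_sup Q
       ((\<lambda>X \<omega>. ereal (real_cond_exp Q (stopped_algebra M F \<sigma>) (\<lambda>\<omega>'. - X \<omega>') \<omega> - \<rho> \<sigma> \<tau> X \<omega>))
         ` Linfty M (stopped_algebra M F \<tau>))
       \<alpha>"

text \<open>\<^term>\<open>absolutely_continuous M Q\<close> means that \<open>Q\<close> is absolutely continuous with respect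
  to \<open>M\<close>.\<close>

definition zero_penalty_measures ::
    "'a measure \<Rightarrow> (ennreal \<Rightarrow> 'a measure) \<Rightarrow> 'a risk_family \<Rightarrow> ('a \<Rightarrow> ennreal) \<Rightarrow> 'a measure set"
where
  "zero_penalty_measures M F \<rho> T =
     {Q. prob_space Q \<and> sets Q = sets M \<and> absolutely_continuous M Q \<and>
         is_min_penalty M F \<rho> (\<lambda>_. 0) T Q (\<lambda>_. 0)}"

definition supermartingale ::
    "'a measure \<Rightarrow> (ennreal \<Rightarrow> 'a measure) \<Rightarrow> (real \<Rightarrow> 'a \<Rightarrow> real) \<Rightarrow> bool" where
  "supermartingale Q F Y \<longleftrightarrow>
     (\<forall>t\<ge>0. Y t \<in> borel_measurable (F (ennreal t)) \<and> integrable Q (Y t)) \<and>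
     (\<forall>s\<ge>0. \<forall>t\<ge>s. AE \<omega> in Q. real_cond_exp Q (F (ennreal s)) (Y t) \<omega> \<le> Y s \<omega>)"

definition cadlag :: "(real \<Rightarrow> real) \<Rightarrow> bool" where
  "cadlag y \<longleftrightarrow>
     (\<forall>t\<ge>0. (y \<longlongrightarrow> y t) (at_right t)) \<and> (\<forall>t>0. \<exists>l. (y \<longlongrightarrow> l) (at_left t))"

end

theory Submission
  imports Defs
begin

text \<open>
  Write \<open>U \<sigma> = \<rho>\<^bsub>\<sigma>,T\<^esub>(X)\<close>.  Testing \<open>\<alpha>\<^sup>m\<^bsub>0,T\<^esub>(Q) = 0\<close> with \<open>1\<^sub>A (U \<sigma> - U \<tau>)\<close>, whose risk
  vanishes by locality and time consistency, gives \<open>E\<^sub>Q(U \<tau> | \<F>\<^sub>\<sigma>) \<le> U \<sigma>\<close> for \<open>\<sigma> \<le> \<tau> \<le> T\<close>.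
  If \<open>\<tau>\<^sub>n\<close> decreases to \<open>\<tau>\<close> and \<open>U \<tau>\<^sub>n \<rightarrow> l\<close>, then the supermartingale property gives
  \<open>E\<^sub>Q l \<le> E\<^sub>Q (U \<tau>)\<close>, while \<open>U \<tau> \<le> l\<close> follows, without any dual representation, from continuity
  from above applied to \<open>1\<^bsub>A\<^sub>n\<^esub> (X + l)\<close> with \<open>A\<^sub>n = {U \<tau>\<^sub>n \<le> l + e}\<close>; hence \<open>U \<tau> = l\<close>.
  One-sided limits along the dyadics exist because a supermartingale bounded by \<open>c\<close> makes on
  average at most \<open>5 c\<^sup>2 / e\<^sup>2\<close> moves of size \<open>e\<close> along any grid.  So \<open>Y t\<close> can be taken
  as the limit of \<open>U (s \<and> T)\<close> for dyadic \<open>s\<close> decreasing strictly to \<open>t\<close>, and approximating a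
  finite stopping time from above by dyadic ones identifies \<open>Y\<close> at that time.
\<close>

section \<open>Counting the moves of a path\<close>

text \<open>A greedy reference level: it jumps to the current value as soon as that value is at
  least \<open>e\<close> away. Index \<open>i\<close> looks only at \<open>y 0, ..., y i\<close>, so
  along an adapted process it is an admissible integrand for the next increment.\<close>

primrec move_ref :: "real \<Rightarrow> (nat \<Rightarrow> real) \<Rightarrow> nat \<Rightarrow> real" where
  "move_ref e y 0 = y 0"
| "move_ref e y (Suc i) = (if e \<le> \<bar>y (Suc i) - move_ref e y i\<bar> then y (Suc i) else move_ref e y i)"

definition moves :: "real \<Rightarrow> (nat \<Rightarrow> real) \<Rightarrow> nat set" where
  "moves e y = {i. e \<le> \<bar>y (Suc i) - move_ref e y i\<bar>}"

lemma abs_move_ref_le: "(\<And>i. \<bar>y i\<bar> \<le> c) \<Longrightarrow> \<bar>move_ref e y i\<bar> \<le> c"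
  by (induction i) auto

lemma abs_diff_move_ref_less: "0 < e \<Longrightarrow> \<bar>y i - move_ref e y i\<bar> < e"
  by (cases i) auto

text \<open>With \<open>r = move_ref e y N\<close>, the squares satisfy \<open>(y (Suc N) -
  r)\<^sup>2 = (y N - r)\<^sup>2 + (y (Suc N))\<^sup>2 - (y N)\<^sup>2 - 2 * r * (y (Suc N) - y
  N)\<close>. A move resets the left side, which is at least \<open>e\<^sup>2\<close>, to zero and
  so pays for one unit of the count.\<close>

lemma card_moves_le:
  assumes "0 \<le> e"
  shows "e\<^sup>2 * real (card (moves e y \<inter> {..<N})) + (y N - move_ref e y N)\<^sup>2
    \<le> (y N)\<^sup>2 - (y 0)\<^sup>2 - 2 * (\<Sum>i<N. move_ref e y i * (y (Suc i) - y i))"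
proof (induction N)
  case (Suc N)
  have *: "moves e y \<inter> {..<Suc N} = (if N \<in> moves e y then {N} else {}) \<union> (moves e y \<inter> {..<N})"
    by (auto simp: less_Suc_eq)
  show ?case
  proof (cases "N \<in> moves e y")
    case True
    then have c: "card (moves e y \<inter> {..<Suc N}) = Suc (card (moves e y \<inter> {..<N}))"
      unfolding * by (simp add: card_insert_if)
    have "e\<^sup>2 \<le> (y (Suc N) - move_ref e y N)\<^sup>2"
      using True assms by (simp add: moves_def abs_le_square_iff[symmetric])
    with Suc.IH show ?thesis
      using True unfolding c by (simp add: moves_def power2_eq_square algebra_simps)
  next
    case False
    then have c: "card (moves e y \<inter> {..<Suc N}) = card (moves e y \<inter> {..<N})"
      unfolding * by simp
    show ?thesis using Suc.IH False unfolding c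
      by (simp add: moves_def power2_eq_square algebra_simps)
  qed
qed simp

text \<open>Without a move between \<open>j\<close> and \<open>k\<close> the reference stays fixed,
  and both \<open>y j\<close> and \<open>y k\<close> are less than \<open>e\<close> away from
  it.\<close>

lemma exists_move_between:
  assumes "0 < e" "j < k" "2 * e \<le> \<bar>y j - y k\<bar>"
  shows "\<exists>i\<in>moves e y. j < Suc i \<and> Suc i \<le> k"
proof (rule ccontr)
  assume none: "\<not> ?thesis"
  have no: "i \<notin> moves e y" if "j \<le> i" "i < k" for i
    using none that by (meson Suc_leI le_imp_less_Suc)
  have "j \<le> k" using assms(2) by simp
  then have "move_ref e y k = move_ref e y j"
  proof (rule dec_induct)
    fix m assume "j \<le> m" "m < k" and IH: "move_ref e y m = move_ref e y j"
    from no[OF this(1,2)] have "\<not> e \<le> \<bar>y (Suc m) - move_ref e y m\<bar>"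
      unfolding moves_def mem_Collect_eq .
    then show "move_ref e y (Suc m) = move_ref e y j" using IH by simp
  qed (rule refl)
  then show False
    using abs_diff_move_ref_less[OF assms(1), of y j] abs_diff_move_ref_less[OF assms(1), of y k] assms(3)
    by linarith
qed

section \<open>Dyadic grids and dyadic approximation from above\<close>

lemma dyadicsE:
  assumes "s \<in> dyadics"
  obtains i n where "(s::real) = real i / 2 ^ n"
  using assms by (auto simp: dyadics_def)

text \<open>Floor plus one instead of a ceiling keeps the approximation strictly above
  \<open>t\<close> even when \<open>t\<close> is dyadic, so limits along it never involve the value
  at \<open>t\<close>.\<close>

definition dyadic_above :: "nat \<Rightarrow> real \<Rightarrow> real" where
  "dyadic_above n t = (of_int \<lfloor>t * 2 ^ n\<rfloor> + 1) / 2 ^ n"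

definition grid :: "(real \<Rightarrow> real) \<Rightarrow> nat \<Rightarrow> nat \<Rightarrow> real" where
  "grid y n i = y (real i / 2 ^ n)"

lemma eventually_on_grid:
  assumes "s \<in> dyadics"
  shows "\<forall>\<^sub>F n in sequentially. \<exists>i\<le>4 ^ n. s = real i / 2 ^ n"
proof -
  obtain i m where s: "s = real i / 2 ^ m" using assms by (rule dyadicsE)
  \<comment> \<open>\<open>m <= n\<close> puts \<open>s\<close> on the grid; \<open>i <= n\<close>
    keeps it within reach, since \<open>4 ^ n\<close> steps of length \<open>1 / 2 ^ n\<close> end
    at time \<open>2 ^ n\<close>.\<close>
  have "\<exists>j\<le>4 ^ n. s = real j / 2 ^ n" if n: "max i m \<le> n" for n
  proof (intro exI conjI)
    have "(2::nat) ^ n = 2 ^ m * 2 ^ (n - m)" using n by (simp flip: power_add)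
    then have "(2::real) ^ n = 2 ^ m * 2 ^ (n - m)" by (simp flip: power_add)
    then show "s = real (i * 2 ^ (n - m)) / 2 ^ n" by (simp add: s)
    have "i \<le> 2 ^ n" using n less_exp[of n] by linarith
    then have "i * 2 ^ (n - m) \<le> 2 ^ n * 2 ^ n" by (intro mult_mono) auto
    also have "\<dots> = 4 ^ n" by (simp flip: power_mult_distrib)
    finally show "i * 2 ^ (n - m) \<le> 4 ^ n" .
  qed
  then show ?thesis by (rule eventually_sequentiallyI)
qed

text \<open>Each member of the family contains an oscillation over \<open>(s, s']\<close> and,
  disjoint from it, another member, so \<open>K\<close> disjoint oscillations can be peeled off one
  by one. Once the grid contains all their endpoints, \<open>exists_move_between\<close> puts a move
  into each.\<close>

lemma eventually_many_moves:
  fixes y :: "real \<Rightarrow> real" and \<B> :: "real set set"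
  assumes e: "0 < e"
    and osc: "\<And>B. B \<in> \<B> \<Longrightarrow> \<exists>s\<in>B \<inter> dyadics. \<exists>s'\<in>B \<inter> dyadics. s < s' \<and> {s<..s'} \<subseteq> B \<and>
      2 * e \<le> \<bar>y s - y s'\<bar> \<and> (\<exists>B'\<in>\<B>. B' \<subseteq> B - {s<..s'})"
    and B: "B \<in> \<B>"
  shows "\<forall>\<^sub>F n in sequentially. K \<le> card (moves e (grid y n) \<inter> {..<4 ^ n})"
proof -
  \<comment> \<open>The induction counts only moves whose right endpoint lies in \<open>B\<close>;
    this keeps those found in \<open>B'\<close> apart from the new one in
    \<open>(s, s']\<close>.\<close>
  have "\<forall>\<^sub>F n in sequentially.
      K \<le> card {i\<in>moves e (grid y n) \<inter> {..<4 ^ n}. real (Suc i) / 2 ^ n \<in> B}"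
    using B
  proof (induction K arbitrary: B)
    case (Suc K)
    obtain s s' B' where s: "s \<in> dyadics" "s' \<in> dyadics" "s < s'" "{s<..s'} \<subseteq> B"
      "2 * e \<le> \<bar>y s - y s'\<bar>" and B': "B' \<in> \<B>" "B' \<subseteq> B - {s<..s'}"
      using osc[OF Suc.prems] by blast
    show ?case
      using Suc.IH[OF B'(1)] eventually_on_grid[OF s(1)] eventually_on_grid[OF s(2)]
    proof eventually_elim
      case (elim n)
      let ?S = "\<lambda>C. {i\<in>moves e (grid y n) \<inter> {..<4 ^ n}. real (Suc i) / 2 ^ n \<in> C}"
      obtain j k where j: "s = real j / 2 ^ n" and k: "k \<le> 4 ^ n" "s' = real k / 2 ^ n"
        using elim by auto
      have "j < k" using s(3) unfolding j k by (simp add: divide_less_cancel)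
      moreover have "2 * e \<le> \<bar>grid y n j - grid y n k\<bar>" using s(5) by (simp add: grid_def j k)
      ultimately obtain i where i: "i \<in> moves e (grid y n)" "j < Suc i" "Suc i \<le> k"
        using exists_move_between[OF e] by blast
      have in_ss: "real (Suc i) / 2 ^ n \<in> {s<..s'}"
        using i unfolding j k greaterThanAtMost_iff
        by (intro conjI divide_strict_right_mono divide_right_mono) simp_all
      then have iB: "i \<in> ?S B" "i \<notin> ?S B'" using i k(1) s(4) B'(2) by auto
      have "Suc K \<le> card (insert i (?S B'))"
        using elim(1) iB(2) by (simp add: card_insert_if)
      also have "\<dots> \<le> card (?S B)"
        using iB(1) B'(2) by (intro card_mono) auto
      finally show ?case .
    qed
  qed simp
  then show ?thesis
    by eventually_elim (erule order_trans, intro card_mono, auto)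
qed

lemma dyadic_above_gt: "t < dyadic_above n t"
  and dyadic_above_le: "dyadic_above n t \<le> t + 1 / 2 ^ n"
proof -
  have "t * 2 ^ n < of_int \<lfloor>t * 2 ^ n\<rfloor> + 1" by linarith
  then show "t < dyadic_above n t" by (simp add: dyadic_above_def field_simps)
  have "of_int \<lfloor>t * 2 ^ n\<rfloor> + 1 \<le> t * 2 ^ n + 1" by linarith
  then show "dyadic_above n t \<le> t + 1 / 2 ^ n" by (simp add: dyadic_above_def field_simps)
qed

lemma dyadic_above_eq:
  assumes "0 \<le> t" shows "\<exists>i. dyadic_above n t = real (Suc i) / 2 ^ n"
proof
  show "dyadic_above n t = real (Suc (nat \<lfloor>t * 2 ^ n\<rfloor>)) / 2 ^ n"
    using assms by (simp add: dyadic_above_def)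
qed

lemma dyadic_above_in_dyadics:
  assumes "0 \<le> t" shows "dyadic_above n t \<in> dyadics"
proof -
  obtain i where "dyadic_above n t = real (Suc i) / 2 ^ n"
    using dyadic_above_eq[OF assms] by blast
  then show ?thesis unfolding dyadics_def by blast
qed

lemma dyadic_above_tendsto: "(\<lambda>n. dyadic_above n t) \<longlonglongrightarrow> t"
proof (rule tendsto_sandwich[where f = "\<lambda>_. t" and h = "\<lambda>n. t + 1 / 2 ^ n"])
  show "(\<lambda>n. t + 1 / 2 ^ n) \<longlonglongrightarrow> t"
    using tendsto_add[OF tendsto_const[of t] LIMSEQ_divide_realpow_zero[of 2 1]] by simp
  show "\<forall>\<^sub>F n in sequentially. t \<le> dyadic_above n t" using dyadic_above_gt by (simp add: less_imp_le)
  show "\<forall>\<^sub>F n in sequentially. dyadic_above n t \<le> t + 1 / 2 ^ n" using dyadic_above_le by simp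
qed auto

lemma dyadic_above_Suc_le: "dyadic_above (Suc n) t \<le> dyadic_above n t"
proof -
  have "t * 2 ^ n < of_int \<lfloor>t * 2 ^ n\<rfloor> + 1" by linarith
  then have "t * 2 ^ Suc n < of_int (2 * \<lfloor>t * 2 ^ n\<rfloor> + 2)" by (simp add: algebra_simps)
  then have "\<lfloor>t * 2 ^ Suc n\<rfloor> + 1 \<le> 2 * \<lfloor>t * 2 ^ n\<rfloor> + 2" by (simp only: floor_less_iff flip: zle_add1_eq_le) linarith
  then have "of_int (\<lfloor>t * 2 ^ Suc n\<rfloor> + 1) \<le> (of_int (2 * \<lfloor>t * 2 ^ n\<rfloor> + 2) :: real)"
    by (simp only: of_int_le_iff)
  then have "(of_int \<lfloor>t * 2 ^ Suc n\<rfloor> + 1) / 2 ^ Suc n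
      \<le> (2 * (of_int \<lfloor>t * 2 ^ n\<rfloor> + 1) :: real) / 2 ^ Suc n"
    by (intro divide_right_mono) auto
  also have "\<dots> = (of_int \<lfloor>t * 2 ^ n\<rfloor> + 1) / 2 ^ n" by (simp only: power_Suc)
  finally show ?thesis unfolding dyadic_above_def .
qed

text \<open>Both sides compare floors. The strict form on the right, at a level not exceeding
  \<open>r\<close>, is what makes \<open>dyadic_time\<close> a stopping time.\<close>

lemma dyadic_above_le_iff: "dyadic_above n x \<le> r \<longleftrightarrow> x < of_int \<lfloor>r * 2 ^ n\<rfloor> / 2 ^ n"
proof -
  have "dyadic_above n x \<le> r \<longleftrightarrow> of_int (\<lfloor>x * 2 ^ n\<rfloor> + 1) \<le> r * 2 ^ n"
    by (simp add: dyadic_above_def field_simps)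
  also have "\<dots> \<longleftrightarrow> \<lfloor>x * 2 ^ n\<rfloor> < \<lfloor>r * 2 ^ n\<rfloor>"
    by (simp only: le_floor_iff[symmetric] zless_iff_Suc_zadd zle_add1_eq_le add1_zle_eq)
  also have "\<dots> \<longleftrightarrow> x < of_int \<lfloor>r * 2 ^ n\<rfloor> / 2 ^ n"
    by (simp add: floor_less_iff field_simps)
  finally show ?thesis .
qed

lemma filterlim_dyadic_above:
  assumes "0 \<le> t"
  shows "filterlim (\<lambda>n. dyadic_above n t) (at t within {t<..} \<inter> dyadics) sequentially"
proof -
  have "dyadic_above n t \<in> {t<..} \<inter> dyadics \<and> dyadic_above n t \<noteq> t" for n
    using dyadic_above_gt[of t n] dyadic_above_in_dyadics[OF assms, of n] by auto
  then show ?thesis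
    using dyadic_above_tendsto[of t] unfolding filterlim_at by simp
qed

lemma dyadics_dense:
  assumes "0 \<le> a" "a < b"
  obtains s :: real where "s \<in> dyadics" "a < s" "s < b"
proof -
  have "\<forall>\<^sub>F n in sequentially. dyadic_above n a < b"
    using dyadic_above_tendsto assms(2) by (rule order_tendstoD)
  then obtain n where "dyadic_above n a < b" by (auto simp: eventually_sequentially)
  then show ?thesis using that dyadic_above_gt dyadic_above_in_dyadics assms(1) by blast
qed

lemma at_left_dyadics_neq_bot:
  fixes t :: real assumes "0 < t" shows "at t within {..<t} \<inter> dyadics \<noteq> bot"
proof -
  have "t islimpt {..<t} \<inter> dyadics"
    unfolding islimpt_approachable
  proof (intro allI impI)
    fix d :: real assume d: "0 < d"
    obtain s where "s \<in> dyadics" "max 0 (t - d) < s" "s < t"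
      using dyadics_dense[of "max 0 (t - d)" t] assms d by auto
    then show "\<exists>x'\<in>{..<t} \<inter> dyadics. x' \<noteq> t \<and> dist x' t < d"
      by (intro bexI[of _ s]) (auto simp: dist_real_def)
  qed
  then show ?thesis by (simp add: trivial_limit_within)
qed

section \<open>One-sided limits and cadlag paths from the count of moves\<close>

lemma filterlim_real_Cauchy:
  fixes y :: "'b \<Rightarrow> real"
  assumes "G \<noteq> bot" and "\<And>e. 0 < e \<Longrightarrow> \<exists>P. eventually P G \<and> (\<forall>x x'. P x \<longrightarrow> P x' \<longrightarrow> \<bar>y x - y x'\<bar> < e)"
  shows "\<exists>l. (y \<longlongrightarrow> l) G"
proof -
  have "cauchy_filter (filtermap y G)"
    using assms(2) unfolding cauchy_filter_metric_filtermap dist_real_def by meson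
  moreover have "filtermap y G \<noteq> bot" using assms(1) by (simp add: filtermap_bot_iff)
  ultimately obtain l where "filtermap y G \<le> nhds l"
    using cauchy_filter_complete_converges[of "filtermap y G" UNIV] complete_UNIV by auto
  then show ?thesis by (auto simp: filterlim_def)
qed

text \<open>The number of moves need not increase when the grid is refined, so Fatou's lemma bounds
  it only along infinitely many grids; this is enough for one-sided limits to exist.\<close>

definition tame_on_dyadics :: "(real \<Rightarrow> real) \<Rightarrow> bool" where
  "tame_on_dyadics y \<longleftrightarrow>
     (\<forall>k. \<exists>K. \<exists>\<^sub>F n in sequentially. card (moves (1 / real (Suc k)) (grid y n) \<inter> {..<4 ^ n}) < K)"

text \<open>The sets \<open>I d\<close> are one-sided neighbourhoods, so left and right limits are
  treated together. If the path were not Cauchy, every \<open>I d\<close> would contain an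
  oscillation of fixed size, and \<open>eventually_many_moves\<close> would push the counts above
  any \<open>K\<close> on all fine grids.\<close>

lemma tame_one_sided_limit:
  fixes I :: "real \<Rightarrow> real set"
  assumes tame: "tame_on_dyadics y"
    and G: "G \<noteq> bot" "\<And>d. 0 < d \<Longrightarrow> eventually (\<lambda>s. s \<in> I d \<inter> dyadics) G"
    and I: "\<And>d s s'. \<lbrakk>0 < d; s \<in> I d; s' \<in> I d; s < s'\<rbrakk> \<Longrightarrow>
      {s<..s'} \<subseteq> I d \<and> (\<exists>d'>0. I d' \<subseteq> I d - {s<..s'})"
  shows "\<exists>l. (y \<longlongrightarrow> l) G"
proof (rule filterlim_real_Cauchy[OF G(1)])
  fix e :: real assume "0 < e"
  \<comment> \<open>Oscillations below \<open>2 * ?e\<close> are then below \<open>e\<close>, as the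
    Cauchy criterion asks.\<close>
  then obtain k where k: "1 / real (Suc k) < e / 2"
    using nat_approx_posE[of "e / 2"] by auto
  let ?e = "1 / real (Suc k)"
  have "\<exists>d>0. \<forall>s\<in>I d \<inter> dyadics. \<forall>s'\<in>I d \<inter> dyadics. s < s' \<longrightarrow> \<bar>y s - y s'\<bar> < 2 * ?e"
  proof (rule ccontr)
    assume "\<not> ?thesis"
    then have N: "\<exists>s\<in>I d \<inter> dyadics. \<exists>s'\<in>I d \<inter> dyadics. s < s' \<and> 2 * ?e \<le> \<bar>y s - y s'\<bar>"
      if "0 < d" for d
      using that by (meson not_less)
    have "\<forall>\<^sub>F n in sequentially. K \<le> card (moves ?e (grid y n) \<inter> {..<4 ^ n})" for K
    proof (rule eventually_many_moves[where \<B> = "I ` {0<..}" and B = "I 1"])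
      fix B assume "B \<in> I ` {0<..}"
      then obtain d where d: "B = I d" "0 < d" by auto
      obtain s s' where s: "s \<in> I d \<inter> dyadics" "s' \<in> I d \<inter> dyadics" "s < s'"
        "2 * ?e \<le> \<bar>y s - y s'\<bar>" using N[OF d(2)] by auto
      with I[OF d(2), of s s'] show "\<exists>s\<in>B \<inter> dyadics. \<exists>s'\<in>B \<inter> dyadics. s < s' \<and> {s<..s'} \<subseteq> B \<and>
          2 * ?e \<le> \<bar>y s - y s'\<bar> \<and> (\<exists>B'\<in>I ` {0<..}. B' \<subseteq> B - {s<..s'})"
        unfolding d(1) by (intro bexI[of _ s] bexI[of _ s']) auto
    qed auto
    then show False using tame by (auto simp: tame_on_dyadics_def frequently_def not_less)
  qed
  then obtain d where d: "0 < d" and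
    lt: "\<And>s s'. \<lbrakk>s \<in> I d \<inter> dyadics; s' \<in> I d \<inter> dyadics; s < s'\<rbrakk> \<Longrightarrow> \<bar>y s - y s'\<bar> < 2 * ?e"
    by blast
  have "\<bar>y s - y s'\<bar> < e" if "s \<in> I d \<inter> dyadics" "s' \<in> I d \<inter> dyadics" for s s'
    using lt[OF that] lt[OF that(2,1)] k \<open>0 < e\<close> by (cases s s' rule: linorder_cases) auto
  then show "\<exists>P. eventually P G \<and> (\<forall>x x'. P x \<longrightarrow> P x' \<longrightarrow> \<bar>y x - y x'\<bar> < e)"
    using G(2)[OF d] by blast
qed

text \<open>Using \<open>lim\<close> along one fixed sequence makes this total and, for random paths
  and times, a countable limit of measurable functions; on tame paths it is the full right limit
  along the dyadics.\<close>

definition right_limit :: "(real \<Rightarrow> real) \<Rightarrow> real \<Rightarrow> real" where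
  "right_limit y t = lim (\<lambda>n. y (dyadic_above n t))"

lemma tame_right_limit:
  assumes "tame_on_dyadics y" "0 \<le> t"
  shows "(y \<longlongrightarrow> right_limit y t) (at t within {t<..} \<inter> dyadics)"
proof -
  let ?G = "at t within {t<..} \<inter> dyadics"
  have lim: "filterlim (\<lambda>n. dyadic_above n t) ?G sequentially"
    using assms(2) by (rule filterlim_dyadic_above)
  then have "?G \<noteq> bot"
    using bot.extremum_uniqueI[of "filtermap (\<lambda>n. dyadic_above n t) sequentially"]
    by (auto simp: filterlim_def filtermap_bot_iff)
  then have "\<exists>l. (y \<longlongrightarrow> l) ?G"
    \<comment> \<open>Removing \<open>(s, s']\<close> leaves \<open>(t, s)\<close>, of length
      \<open>s - t\<close>.\<close>
    by (rule tame_one_sided_limit[where I = "\<lambda>d. {t<..<t + d}", OF assms(1)])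
      (auto simp: eventually_at dist_real_def intro!: exI[of _ "_ - t"])
  then obtain l where l: "(y \<longlongrightarrow> l) ?G" by blast
  then have "right_limit y t = l"
    unfolding right_limit_def by (intro limI filterlim_compose[OF l lim])
  then show ?thesis using l by simp
qed

lemma cadlag_right_limit:
  assumes "tame_on_dyadics y"
  shows "cadlag (right_limit y)"
  unfolding cadlag_def
proof safe
  \<comment> \<open>Bounds at dyadic times pass to \<open>right_limit\<close> only in non-strict
    form; the margin \<open>e / 2\<close> used below restores strictness.\<close>
  have closed_bound: "\<bar>right_limit y u - l\<bar> \<le> e"
    if "0 \<le> u" "u < b" "\<And>s. s \<in> dyadics \<Longrightarrow> u < s \<Longrightarrow> s < b \<Longrightarrow> \<bar>y s - l\<bar> \<le> e" for u b l e
  proof (rule tendsto_upperbound)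
    have lim: "filterlim (\<lambda>n. dyadic_above n u) (at u within {u<..} \<inter> dyadics) sequentially"
      using that(1) by (rule filterlim_dyadic_above)
    show "(\<lambda>n. \<bar>y (dyadic_above n u) - l\<bar>) \<longlonglongrightarrow> \<bar>right_limit y u - l\<bar>"
      by (intro tendsto_intros filterlim_compose[OF tame_right_limit[OF assms that(1)] lim])
    have "\<forall>\<^sub>F n in sequentially. dyadic_above n u < b"
      using dyadic_above_tendsto that(2) by (rule order_tendstoD)
    then show "\<forall>\<^sub>F n in sequentially. \<bar>y (dyadic_above n u) - l\<bar> \<le> e"
      by eventually_elim (intro that(3) dyadic_above_in_dyadics dyadic_above_gt that(1))
  qed simp
  fix t :: real
  show "(right_limit y \<longlongrightarrow> right_limit y t) (at_right t)" if t: "0 \<le> t"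
  proof (rule tendstoI)
    fix e :: real assume e: "0 < e"
    have "\<forall>\<^sub>F s in at t within {t<..} \<inter> dyadics. dist (y s) (right_limit y t) < e / 2"
      using tendstoD[OF tame_right_limit[OF assms t], of "e / 2"] e by simp
    then obtain d where d: "0 < d"
      "\<And>s. s \<in> {t<..} \<inter> dyadics \<Longrightarrow> s < t + d \<Longrightarrow> \<bar>y s - right_limit y t\<bar> < e / 2"
      unfolding eventually_at by (force simp: dist_real_def)
    have "\<bar>right_limit y u - right_limit y t\<bar> \<le> e / 2" if "t < u" "u < t + d" for u
      using that t d(2) by (intro closed_bound[of u "t + d"]) (auto intro: less_imp_le)
    then show "\<forall>\<^sub>F u in at_right t. dist (right_limit y u) (right_limit y t) < e"
      using e d(1) unfolding eventually_at_right_field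
      by (intro exI[of _ "t + d"]) (force simp: dist_real_def)
  qed
  show "\<exists>l. (right_limit y \<longlongrightarrow> l) (at_left t)" if t: "0 < t"
  proof -
    have "\<exists>l. (y \<longlongrightarrow> l) (at t within {..<t} \<inter> dyadics)"
      \<comment> \<open>Here \<open>(s', t)\<close> remains, of length
        \<open>t - s'\<close>.\<close>
      by (rule tame_one_sided_limit[where I = "\<lambda>d. {t - d<..<t}", OF assms at_left_dyadics_neq_bot[OF t]])
        (auto simp: eventually_at dist_real_def intro!: exI[of _ "t - _"])
    then obtain l where l: "(y \<longlongrightarrow> l) (at t within {..<t} \<inter> dyadics)" by blast
    have "(right_limit y \<longlongrightarrow> l) (at_left t)"
    proof (rule tendstoI)
      fix e :: real assume e: "0 < e"
      have "\<forall>\<^sub>F s in at t within {..<t} \<inter> dyadics. dist (y s) l < e / 2"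
        using tendstoD[OF l, of "e / 2"] e by simp
      then obtain d where d: "0 < d"
        "\<And>s. s \<in> {..<t} \<inter> dyadics \<Longrightarrow> t - d < s \<Longrightarrow> \<bar>y s - l\<bar> < e / 2"
        unfolding eventually_at by (force simp: dist_real_def)
      have "\<bar>right_limit y u - l\<bar> \<le> e / 2" if "max 0 (t - d) < u" "u < t" for u
        using that t d(2) by (intro closed_bound[of u t]) (auto intro: less_imp_le)
      then show "\<forall>\<^sub>F u in at_left t. dist (right_limit y u) l < e"
        using e d(1) t unfolding eventually_at_left_field
        by (intro exI[of _ "max 0 (t - d)"]) (force simp: dist_real_def)
    qed
    then show ?thesis ..
  qed
qed

section \<open>Bounded supermartingales along the dyadics\<close>

text \<open>Test on the event where the conditional expectation exceeds \<open>U\<close>: the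
  difference is positive there but has integral at most zero, so the event is null.\<close>

lemma (in prob_space) real_cond_exp_leI:
  assumes sub: "subalgebra M G" and V: "integrable M V" and U: "integrable M U" "U \<in> borel_measurable G"
    and le: "\<And>A. A \<in> sets G \<Longrightarrow> (\<integral>\<omega>. indicator A \<omega> * V \<omega> \<partial>M) \<le> (\<integral>\<omega>. indicator A \<omega> * U \<omega> \<partial>M)"
  shows "AE \<omega> in M. real_cond_exp M G V \<omega> \<le> U \<omega>"
proof -
  interpret finite_measure_subalgebra M G by unfold_locales (rule sub)
  let ?E = "real_cond_exp M G V"
  define A where "A = {\<omega> \<in> space G. U \<omega> < ?E \<omega>}"
  have AG: "A \<in> sets G" unfolding A_def using U(2) by measurable
  then have AM: "A \<in> sets M" using sub by (auto simp: subalgebra_def)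
  have E: "integrable M ?E" using V by (rule real_cond_exp_int)
  have iV: "integrable M (\<lambda>\<omega>. indicator A \<omega> * V \<omega>)" and iU: "integrable M (\<lambda>\<omega>. indicator A \<omega> * U \<omega>)"
    and iE: "integrable M (\<lambda>\<omega>. indicator A \<omega> * ?E \<omega>)"
    using integrable_mult_indicator[OF AM V] integrable_mult_indicator[OF AM U(1)]
      integrable_mult_indicator[OF AM E] unfolding real_scaleR_def .
  have "(\<integral>\<omega>. indicator A \<omega> * ?E \<omega> \<partial>M) = (\<integral>\<omega>. indicator A \<omega> * V \<omega> \<partial>M)"
    using AG V by (intro real_cond_exp_intg iV) auto
  then have "(\<integral>\<omega>. indicator A \<omega> * ?E \<omega> - indicator A \<omega> * U \<omega> \<partial>M) \<le> 0"
    using le[OF AG] by (simp add: iE iU)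
  moreover have nn: "0 \<le> indicator A \<omega> * ?E \<omega> - indicator A \<omega> * U \<omega>" for \<omega>
    by (auto simp: A_def indicator_def)
  then have "0 \<le> (\<integral>\<omega>. indicator A \<omega> * ?E \<omega> - indicator A \<omega> * U \<omega> \<partial>M)"
    by (intro integral_nonneg_AE AE_I2)
  ultimately have "(\<integral>\<omega>. indicator A \<omega> * ?E \<omega> - indicator A \<omega> * U \<omega> \<partial>M) = 0"
    by (rule antisym)
  then have "AE \<omega> in M. indicator A \<omega> * ?E \<omega> - indicator A \<omega> * U \<omega> = 0"
    using integral_nonneg_eq_0_iff_AE[OF Bochner_Integration.integrable_diff[OF iE iU] AE_I2[OF nn]]
    by blast
  with AE_space show ?thesis
    by eventually_elim (use sub in \<open>auto simp: A_def indicator_def subalgebra_def split: if_splits\<close>)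
qed

text \<open>The nonnegative weight is \<open>G\<close>-measurable, so inside the integral
  \<open>V\<close> may be replaced by its conditional expectation.\<close>

lemma (in prob_space) integral_mult_increment_le:
  assumes sub: "subalgebra M G" and V: "integrable M V" and U: "integrable M U"
    and le: "AE \<omega> in M. real_cond_exp M G V \<omega> \<le> U \<omega>"
    and g: "g \<in> borel_measurable G" "\<And>\<omega>. 0 \<le> g \<omega>" "\<And>\<omega>. g \<omega> \<le> C"
  shows "(\<integral>\<omega>. g \<omega> * (V \<omega> - U \<omega>) \<partial>M) \<le> 0"
proof -
  interpret finite_measure_subalgebra M G by unfold_locales (rule sub)
  have [measurable]: "g \<in> borel_measurable M" using g(1) sub by (rule measurable_from_subalg[rotated])
  have bdd: "integrable M (\<lambda>\<omega>. g \<omega> * h \<omega>)" if "integrable M h" for h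
    using that g(2,3)
    by (intro Bochner_Integration.integrable_bound[OF integrable_mult_right[OF that, of C]])
      (auto simp: abs_mult intro!: mult_right_mono AE_I2 intro: order_trans[OF g(3)])
  have "(\<integral>\<omega>. g \<omega> * V \<omega> \<partial>M) = (\<integral>\<omega>. g \<omega> * real_cond_exp M G V \<omega> \<partial>M)"
    using V g(1) by (intro real_cond_exp_intg(2)[symmetric] bdd) auto
  also have "\<dots> \<le> (\<integral>\<omega>. g \<omega> * U \<omega> \<partial>M)"
    using le by (intro integral_mono_AE bdd real_cond_exp_int V U) (auto intro: mult_left_mono g(2))
  finally show ?thesis by (simp add: right_diff_distrib bdd U V)
qed

lemma measurable_move_ref:
  fixes Y :: "nat \<Rightarrow> 'a \<Rightarrow> real"
  assumes "\<And>i. i \<le> k \<Longrightarrow> Y i \<in> borel_measurable G"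
  shows "(\<lambda>\<omega>. move_ref e (\<lambda>i. Y i \<omega>) k) \<in> borel_measurable G"
  using assms
proof (induction k)
  case (Suc k)
  note [measurable] = Suc.IH[OF Suc.prems] Suc.prems[OF order_refl]
  show ?case by simp
qed simp

lemma card_moves_eq_sum:
  fixes y :: "nat \<Rightarrow> real" and N :: nat
  shows "real (card (moves e y \<inter> {..<N})) = (\<Sum>i<N. if e \<le> \<bar>y (Suc i) - move_ref e y i\<bar> then 1 else 0)"
proof -
  have "moves e y \<inter> {..<N} = {i \<in> {..<N}. e \<le> \<bar>y (Suc i) - move_ref e y i\<bar>}"
    by (auto simp: moves_def)
  then show ?thesis by (simp flip: sum.inter_filter)
qed

text \<open>Take expectations in \<open>card_moves_le\<close>. The reference has no fixed sign, so
  it is traded for the weight \<open>c - move_ref\<close>, which lies in \<open>[0, 2 * c]\<close>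
  and makes each expected weighted increment nonpositive. The resulting bound does not depend on
  \<open>N\<close>.\<close>

lemma (in prob_space) expectation_card_moves_le:
  fixes Y :: "nat \<Rightarrow> 'a \<Rightarrow> real" and G :: "nat \<Rightarrow> 'a measure"
  assumes sub: "\<And>i. subalgebra M (G i)" and mono: "\<And>i j. i \<le> j \<Longrightarrow> sets (G i) \<subseteq> sets (G j)"
    and meas: "\<And>i. Y i \<in> borel_measurable (G i)" and bound: "\<And>i \<omega>. \<bar>Y i \<omega>\<bar> \<le> c"
    and super: "\<And>i. AE \<omega> in M. real_cond_exp M (G i) (Y (Suc i)) \<omega> \<le> Y i \<omega>"
    and e: "0 \<le> e"
  shows "integrable M (\<lambda>\<omega>. real (card (moves e (\<lambda>i. Y i \<omega>) \<inter> {..<N})))"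
    and "e\<^sup>2 * expectation (\<lambda>\<omega>. real (card (moves e (\<lambda>i. Y i \<omega>) \<inter> {..<N}))) \<le> 5 * c\<^sup>2"
proof -
  have measG: "Y i \<in> borel_measurable (G k)" if "i \<le> k" for i k
  proof (rule measurable_from_subalg[OF _ meas])
    show "subalgebra (G k) (G i)"
      using mono[OF that] sub[of i] sub[of k] by (simp add: subalgebra_def)
  qed
  have [measurable]: "Y i \<in> borel_measurable M" for i
    using meas sub by (rule measurable_from_subalg[rotated])
  let ?r = "\<lambda>i \<omega>. move_ref e (\<lambda>i. Y i \<omega>) i"
  have r_meas: "?r i \<in> borel_measurable (G i)" for i
    by (rule measurable_move_ref) (rule measG)
  then have [measurable]: "?r i \<in> borel_measurable M" for i
    using sub by (rule measurable_from_subalg[rotated])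
  have r_bound: "\<bar>?r i \<omega>\<bar> \<le> c" for i \<omega>
    using bound by (rule abs_move_ref_le)
  have iY: "integrable M (Y i)" for i
    using bound by (intro integrable_const_bound[of _ c]) auto
  let ?n = "\<lambda>\<omega>. real (card (moves e (\<lambda>i. Y i \<omega>) \<inter> {..<N}))"
  have [measurable]: "?n \<in> borel_measurable M"
    unfolding card_moves_eq_sum by measurable
  have "?n \<omega> \<le> N" for \<omega>
    using card_mono[of "{..<N}" "moves e (\<lambda>i. Y i \<omega>) \<inter> {..<N}"] by auto
  then show int_n: "integrable M ?n"
    by (intro integrable_const_bound[of _ N]) auto
  let ?g = "\<lambda>i \<omega>. (c - ?r i \<omega>) * (Y (Suc i) \<omega> - Y i \<omega>)"
  have g_bound: "\<bar>?g i \<omega>\<bar> \<le> (2 * c) * (2 * c)" for i \<omega>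
    unfolding abs_mult using r_bound[of \<omega> i] bound[of i \<omega>] bound[of "Suc i" \<omega>]
    by (intro mult_mono) auto
  have int_g: "integrable M (?g i)" for i
    using g_bound by (intro integrable_const_bound[of _ "(2 * c) * (2 * c)"]) auto
  \<comment> \<open>One \<open>c\<^sup>2\<close> bounds \<open>(Y N \<omega>)\<^sup>2\<close>; the
    other four bound twice the telescoped sum \<open>c * (Y N \<omega> - Y 0 \<omega>)\<close> that
    the change of weight introduces.\<close>
  have path: "e\<^sup>2 * ?n \<omega> \<le> 5 * c\<^sup>2 + 2 * (\<Sum>i<N. ?g i \<omega>)" for \<omega>
  proof -
    have "(\<Sum>i<N. Y (Suc i) \<omega> - Y i \<omega>) = Y N \<omega> - Y 0 \<omega>"
      by (rule sum_lessThan_telescope)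
    then have "(\<Sum>i<N. ?g i \<omega>) = c * (Y N \<omega> - Y 0 \<omega>) - (\<Sum>i<N. ?r i \<omega> * (Y (Suc i) \<omega> - Y i \<omega>))"
      by (simp add: left_diff_distrib sum_subtractf flip: sum_distrib_left)
    moreover have "\<bar>c * (Y N \<omega> - Y 0 \<omega>)\<bar> \<le> c * (2 * c)"
      unfolding abs_mult using bound[of N \<omega>] bound[of 0 \<omega>] by (intro mult_mono) auto
    then have "- (2 * c\<^sup>2) \<le> c * (Y N \<omega> - Y 0 \<omega>)" by (simp add: power2_eq_square abs_le_iff)
    moreover have "(Y N \<omega>)\<^sup>2 \<le> c\<^sup>2"
      using bound[of N \<omega>] by (simp add: abs_le_square_iff[symmetric])
    moreover have "e\<^sup>2 * ?n \<omega> + (Y N \<omega> - ?r N \<omega>)\<^sup>2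
        \<le> (Y N \<omega>)\<^sup>2 - (Y 0 \<omega>)\<^sup>2 - 2 * (\<Sum>i<N. ?r i \<omega> * (Y (Suc i) \<omega> - Y i \<omega>))"
      using e by (rule card_moves_le)
    moreover have "0 \<le> (Y N \<omega> - ?r N \<omega>)\<^sup>2" "0 \<le> (Y 0 \<omega>)\<^sup>2" by simp_all
    ultimately show ?thesis by linarith
  qed
  have "e\<^sup>2 * expectation ?n = expectation (\<lambda>\<omega>. e\<^sup>2 * ?n \<omega>)" by simp
  also have "\<dots> \<le> expectation (\<lambda>\<omega>. 5 * c\<^sup>2 + 2 * (\<Sum>i<N. ?g i \<omega>))"
    using path int_n int_g by (intro integral_mono) auto
  also have "\<dots> = 5 * c\<^sup>2 + 2 * (\<Sum>i<N. expectation (?g i))"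
    using int_g by (simp add: prob_space)
  also have "(\<Sum>i<N. expectation (?g i)) \<le> 0"
  proof (rule sum_nonpos)
    fix i
    show "expectation (?g i) \<le> 0"
    proof (rule integral_mult_increment_le[OF sub iY iY super])
      show "(\<lambda>\<omega>. c - ?r i \<omega>) \<in> borel_measurable (G i)" using r_meas by simp
      show "0 \<le> c - ?r i \<omega>" "c - ?r i \<omega> \<le> 2 * c" for \<omega> using r_bound[of \<omega> i] by auto
    qed
  qed
  finally show "e\<^sup>2 * expectation ?n \<le> 5 * c\<^sup>2" by simp
qed

text \<open>The expected count is at most \<open>5 * c\<^sup>2 / e\<^sup>2\<close> on every grid, so
  by Fatou's lemma the liminf of the counts is almost surely finite.\<close>

lemma (in prob_space) AE_tame_on_dyadics:
  fixes Y :: "real \<Rightarrow> 'a \<Rightarrow> real" and G :: "real \<Rightarrow> 'a measure"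
  assumes sub: "\<And>t. subalgebra M (G t)" and mono: "\<And>s t. s \<le> t \<Longrightarrow> sets (G s) \<subseteq> sets (G t)"
    and meas: "\<And>t. 0 \<le> t \<Longrightarrow> Y t \<in> borel_measurable (G t)" and bound: "\<And>t \<omega>. \<bar>Y t \<omega>\<bar> \<le> c"
    and super: "\<And>s t. 0 \<le> s \<Longrightarrow> s \<le> t \<Longrightarrow> AE \<omega> in M. real_cond_exp M (G s) (Y t) \<omega> \<le> Y s \<omega>"
  shows "AE \<omega> in M. tame_on_dyadics (\<lambda>t. Y t \<omega>)"
  unfolding tame_on_dyadics_def AE_all_countable
proof
  fix k
  define e where "e = 1 / real (Suc k)"
  have e: "0 < e" by (simp add: e_def)
  let ?n = "\<lambda>n \<omega>. card (moves e (grid (\<lambda>t. Y t \<omega>) n) \<inter> {..<4 ^ n})"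
  have int: "integrable M (\<lambda>\<omega>. real (?n n \<omega>))"
    and le: "e\<^sup>2 * expectation (\<lambda>\<omega>. real (?n n \<omega>)) \<le> 5 * c\<^sup>2" for n
  proof -
    have hyps: "sets (G (real i / 2 ^ n)) \<subseteq> sets (G (real j / 2 ^ n))"
      "Y (real i / 2 ^ n) \<in> borel_measurable (G (real i / 2 ^ n))"
      "AE \<omega> in M. real_cond_exp M (G (real i / 2 ^ n)) (Y (real (Suc i) / 2 ^ n)) \<omega> \<le> Y (real i / 2 ^ n) \<omega>"
      if "i \<le> j" for i j
      using that by (auto intro!: mono meas super simp: divide_right_mono)
    note * = expectation_card_moves_le[where G = "\<lambda>i. G (real i / 2 ^ n)" and
        Y = "\<lambda>i. Y (real i / 2 ^ n)" and c = c and e = e and N = "4 ^ n",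
        OF sub hyps(1) hyps(2)[OF order_refl] bound hyps(3)[OF order_refl] less_imp_le[OF e]]
    from * show "integrable M (\<lambda>\<omega>. real (?n n \<omega>))"
      and "e\<^sup>2 * expectation (\<lambda>\<omega>. real (?n n \<omega>)) \<le> 5 * c\<^sup>2"
      by (simp_all add: grid_def[abs_def])
  qed
  have [measurable]: "(\<lambda>\<omega>. real (?n n \<omega>)) \<in> borel_measurable M" for n
    using int by (rule borel_measurable_integrable)
  have "(\<integral>\<^sup>+\<omega>. ennreal (real (?n n \<omega>)) \<partial>M) \<le> ennreal (5 * c\<^sup>2 / e\<^sup>2)" for n
    using le[of n] e by (subst nn_integral_eq_integral[OF int]) (auto intro!: ennreal_leI simp: field_simps)
  then have "liminf (\<lambda>n. \<integral>\<^sup>+\<omega>. ennreal (real (?n n \<omega>)) \<partial>M) \<le> ennreal (5 * c\<^sup>2 / e\<^sup>2)"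
    by (intro order_trans[OF Liminf_le_Limsup] Limsup_bounded always_eventually) auto
  then have "(\<integral>\<^sup>+\<omega>. liminf (\<lambda>n. ennreal (real (?n n \<omega>))) \<partial>M) \<le> ennreal (5 * c\<^sup>2 / e\<^sup>2)"
    by (rule order_trans[OF nn_integral_liminf, rotated]) measurable
  then have "AE \<omega> in M. liminf (\<lambda>n. ennreal (real (?n n \<omega>))) \<noteq> \<infinity>"
    by (intro nn_integral_PInf_AE) (auto simp: top_unique)
  then show "AE \<omega> in M. \<exists>K. \<exists>\<^sub>F n in sequentially.
      card (moves (1 / real (Suc k)) (grid (\<lambda>t. Y t \<omega>) n) \<inter> {..<4 ^ n}) < K"
  proof eventually_elim
    case (elim \<omega>)
    obtain K where K: "liminf (\<lambda>n. ennreal (real (?n n \<omega>))) < of_nat K"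
      using elim by (auto simp: less_top dest: ennreal_Ex_less_of_nat)
    \<comment> \<open>A liminf below \<open>K\<close> means fewer than \<open>K\<close> moves on
      infinitely many grids.\<close>
    have "\<not> (\<forall>\<^sub>F n in sequentially. K \<le> ?n n \<omega>)"
    proof
      assume "\<forall>\<^sub>F n in sequentially. K \<le> ?n n \<omega>"
      then have "\<forall>\<^sub>F n in sequentially. of_nat K \<le> ennreal (real (?n n \<omega>))"
        by eventually_elim (simp add: ennreal_of_nat_eq_real_of_nat)
      then have "of_nat K \<le> liminf (\<lambda>n. ennreal (real (?n n \<omega>)))"
        by (rule Liminf_bounded)
      with K show False by simp
    qed
    then show ?case by (auto simp: frequently_def not_less e_def)
  qed
qed

section \<open>Stopped \<open>\<sigma>\<close>-algebras and bounded variables\<close>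

lemma Linfty_add: "V \<in> Linfty M G \<Longrightarrow> W \<in> Linfty M G \<Longrightarrow> (\<lambda>\<omega>. V \<omega> + W \<omega>) \<in> Linfty M G"
  unfolding Linfty_def
proof safe
  fix a b assume "AE \<omega> in M. \<bar>V \<omega>\<bar> \<le> a" "AE \<omega> in M. \<bar>W \<omega>\<bar> \<le> b"
  then have "AE \<omega> in M. \<bar>V \<omega> + W \<omega>\<bar> \<le> a + b" by eventually_elim auto
  then show "\<exists>c. AE \<omega> in M. \<bar>V \<omega> + W \<omega>\<bar> \<le> c" by blast
qed simp

lemma Linfty_minus: "W \<in> Linfty M G \<Longrightarrow> (\<lambda>\<omega>. - W \<omega>) \<in> Linfty M G"
  by (simp add: Linfty_def)

lemma Linfty_const: "(\<lambda>_. a) \<in> Linfty M G"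
  by (auto simp: Linfty_def)

lemma Linfty_indicator:
  assumes "A \<in> sets G" "W \<in> Linfty M G"
  shows "(\<lambda>\<omega>. indicator A \<omega> * W \<omega>) \<in> Linfty M G"
proof -
  obtain a where a: "W \<in> borel_measurable G" "AE \<omega> in M. \<bar>W \<omega>\<bar> \<le> a"
    using assms(2) by (auto simp: Linfty_def)
  from a(2) have "AE \<omega> in M. \<bar>indicator A \<omega> * W \<omega>\<bar> \<le> \<bar>a\<bar>"
    by eventually_elim (auto simp: indicator_def)
  then show ?thesis using a(1) assms(1) by (auto simp: Linfty_def)
qed

text \<open>Preimages under \<open>f\<close> and \<open>g\<close> differ only inside a null set. As
  \<open>M\<close> need not be complete, it is the measurability of \<open>f\<close> for
  \<open>M\<close> that makes this difference a null set belonging to \<open>G\<close>.\<close>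

lemma borel_measurable_AE_eq:
  fixes f g :: "'a \<Rightarrow> real"
  assumes sub: "subalgebra M G" and null: "null_sets M \<subseteq> sets G"
    and f: "f \<in> borel_measurable M" and g: "g \<in> borel_measurable G" and eq: "AE \<omega> in M. f \<omega> = g \<omega>"
  shows "f \<in> borel_measurable G"
proof (rule measurableI)
  fix B :: "real set" assume B: "B \<in> sets borel"
  obtain N where N: "N \<in> null_sets M" "\<And>\<omega>. \<omega> \<in> space M - N \<Longrightarrow> f \<omega> = g \<omega>"
    using AE_E3[OF eq] by blast
  have sp: "space G = space M" using sub by (simp add: subalgebra_def)
  have "f -` B \<inter> space M \<inter> N \<in> null_sets M"
    using measurable_sets[OF f B] N(1) by (rule null_set_Int1[rotated])
  then have "(g -` B \<inter> space G - N) \<union> (f -` B \<inter> space M \<inter> N) \<in> sets G"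
    using measurable_sets[OF g B] N(1) null by auto
  also have "(g -` B \<inter> space G - N) \<union> (f -` B \<inter> space M \<inter> N) = f -` B \<inter> space G"
    using N(2) unfolding sp by auto
  finally show "f -` B \<inter> space G \<in> sets G" .
qed simp

text \<open>Both sequences have the same limits, so the identity also holds where neither
  converges.\<close>

lemma lim_shift: "lim (\<lambda>k. f (k + n)) = lim f"
  unfolding lim_def by (metis LIMSEQ_ignore_initial_segment LIMSEQ_offset)

context filtered_prob_space
begin

lemma sets_F_subset: "sets (F t) \<subseteq> sets M"
  using sets_F_mono[of t \<infinity>] sets_F_infinity by simp

lemma null_sets_F: "N \<in> null_sets M \<Longrightarrow> N \<in> sets (F t)"
  using sets_F_mono[of 0 t] sets_F_0 by auto

lemma subalgebra_F: "subalgebra M (F t)"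
  by (simp add: subalgebra_def space_F sets_F_subset)

lemma stopping_time_sets: "stopping_time F \<sigma> \<Longrightarrow> {\<omega> \<in> space M. \<sigma> \<omega> \<le> t} \<in> sets (F t)"
  using stopping_timeD[of F \<sigma> t] by (simp add: pred_def space_F)

lemma subalgebra_pre_sigma:
  assumes "stopping_time F \<sigma>"
  shows "subalgebra M (pre_sigma \<sigma>)"
proof -
  have "A \<in> sets M" if "A \<in> sets (pre_sigma \<sigma>)" for A
    using sets_pre_sigmaD[OF assms that, of \<infinity>] sets_F_infinity by simp
  then show ?thesis by (auto simp: subalgebra_def space_pre_sigma)
qed

lemma null_sets_pre_sigma:
  assumes "stopping_time F \<sigma>"
  shows "null_sets M \<subseteq> sets (pre_sigma \<sigma>)"
proof
  fix N assume N: "N \<in> null_sets M"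
  show "N \<in> sets (pre_sigma \<sigma>)"
  proof (rule sets_pre_sigmaI[OF assms])
    fix t
    have "{\<omega> \<in> space M. \<sigma> \<omega> \<le> t} \<inter> N \<in> null_sets M"
      using N subsetD[OF sets_F_subset stopping_time_sets[OF assms]] by (rule null_set_Int1)
    also have "{\<omega> \<in> space M. \<sigma> \<omega> \<le> t} \<inter> N = {\<omega> \<in> N. \<sigma> \<omega> \<le> t}"
      using sets.sets_into_space N by auto
    finally show "{\<omega> \<in> N. \<sigma> \<omega> \<le> t} \<in> sets (F t)" by (rule null_sets_F)
  qed
qed

lemma sets_pre_sigma_const: "sets (pre_sigma (\<lambda>_. t)) \<subseteq> sets (F t)"
  using sets_pre_sigmaD[OF stopping_time_const, of _ t t] by auto

text \<open>Right continuity of the filtration passes to stopped algebras: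
  \<open>\<tau> <= t\<close> holds exactly when for every \<open>k\<close> some
  \<open>\<tau>s n\<close> is at most \<open>v k\<close>, where the levels \<open>v k\<close> tend
  to \<open>t\<close> from strictly above.\<close>

lemma sets_pre_sigma_right_continuous:
  assumes \<tau>: "stopping_time F \<tau>" and \<tau>s: "\<And>n::nat. stopping_time F (\<tau>s n)"
    and lim: "\<And>\<omega>. \<omega> \<in> space M \<Longrightarrow> (\<lambda>n. \<tau>s n \<omega>) \<longlonglongrightarrow> \<tau> \<omega>"
    and le: "\<And>\<omega> n. \<omega> \<in> space M \<Longrightarrow> \<tau> \<omega> \<le> \<tau>s n \<omega>"
    and A: "\<And>n. A \<in> sets (pre_sigma (\<tau>s n))"
  shows "A \<in> sets (pre_sigma \<tau>)"
proof (rule sets_pre_sigmaI[OF \<tau>])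
  fix t
  have AM: "A \<in> sets M" using A subalgebra_pre_sigma[OF \<tau>s] by (auto simp: subalgebra_def)
  then have A_space: "A \<subseteq> space M" by (rule sets.sets_into_space)
  show "{\<omega> \<in> A. \<tau> \<omega> \<le> t} \<in> sets (F t)"
  proof (cases "t = \<infinity>")
    case True
    then show ?thesis using AM sets_F_infinity by simp
  next
    case False
    then have "t < \<infinity>" by (simp add: less_top)
    have "{\<omega> \<in> A. \<tau> \<omega> \<le> t} \<in> sets (F s)" if "t < s" for s
    proof -
      obtain u where u: "\<And>k::nat. t < u k" "u \<longlonglongrightarrow> t"
        using approx_from_above_dense_linorder[OF \<open>t < s\<close>] by auto
      \<comment> \<open>The cap at \<open>s\<close> keeps all the events in
        \<open>F s\<close>.\<close>
      define v where "v k = min (u k) s" for k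
      have v: "t < v k" "v k \<le> s" for k using u(1) that by (auto simp: v_def)
      have "v \<longlonglongrightarrow> min t s" unfolding v_def by (intro tendsto_min u(2) tendsto_const)
      then have v_lim: "v \<longlonglongrightarrow> t" using that by (simp add: min_absorb1 less_imp_le)
      have "{\<omega> \<in> A. \<tau>s n \<omega> \<le> v k} \<in> sets (F s)" for n k
        using sets_pre_sigmaD[OF \<tau>s A] sets_F_mono[OF v(2)] by blast
      then have "(\<Inter>k. \<Union>n. {\<omega> \<in> A. \<tau>s n \<omega> \<le> v k}) \<in> sets (F s)" by auto
      also have "(\<Inter>k. \<Union>n. {\<omega> \<in> A. \<tau>s n \<omega> \<le> v k}) = {\<omega> \<in> A. \<tau> \<omega> \<le> t}"
      proof (intro equalityI subsetI)
        fix \<omega> assume *: "\<omega> \<in> (\<Inter>k. \<Union>n. {\<omega> \<in> A. \<tau>s n \<omega> \<le> v k})"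
        then have \<omega>: "\<omega> \<in> A" by auto
        have "\<tau> \<omega> \<le> v k" for k
        proof -
          obtain n where "\<tau>s n \<omega> \<le> v k" using * by auto
          then show ?thesis using le[of \<omega> n] \<omega> A_space by (auto intro: order_trans)
        qed
        then have "\<tau> \<omega> \<le> t" by (intro LIMSEQ_le_const[OF v_lim]) auto
        then show "\<omega> \<in> {\<omega> \<in> A. \<tau> \<omega> \<le> t}" using \<omega> by simp
      next
        fix \<omega> assume \<omega>: "\<omega> \<in> {\<omega> \<in> A. \<tau> \<omega> \<le> t}"
        have "\<exists>n. \<tau>s n \<omega> \<le> v k" for k
        proof -
          have "\<tau> \<omega> < v k" using \<omega> v(1)[of k] by (auto intro: le_less_trans)
          then have "\<forall>\<^sub>F n in sequentially. \<tau>s n \<omega> < v k"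
            using lim[of \<omega>] \<omega> A_space by (intro order_tendstoD(2)) auto
          then show ?thesis by (auto simp: eventually_sequentially intro: less_imp_le)
        qed
        then show "\<omega> \<in> (\<Inter>k. \<Union>n. {\<omega> \<in> A. \<tau>s n \<omega> \<le> v k})" using \<omega> by auto
      qed
      finally show ?thesis .
    qed
    then show ?thesis using right_continuous[OF \<open>t < \<infinity>\<close>] by auto
  qed
qed

lemma sets_pre_sigma_eq_on:
  assumes "stopping_time F \<nu>" "stopping_time F \<sigma>"
    and A: "A \<in> sets (pre_sigma \<nu>)" "\<And>\<omega>. \<omega> \<in> A \<Longrightarrow> \<nu> \<omega> = \<sigma> \<omega>" and C: "C \<in> sets (pre_sigma \<sigma>)"
  shows "A \<inter> C \<in> sets (pre_sigma \<nu>)"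
proof (rule sets_pre_sigmaI[OF assms(1)])
  fix t
  have "{\<omega> \<in> A. \<nu> \<omega> \<le> t} \<inter> {\<omega> \<in> C. \<sigma> \<omega> \<le> t} \<in> sets (F t)"
    using sets_pre_sigmaD assms by blast
  also have "{\<omega> \<in> A. \<nu> \<omega> \<le> t} \<inter> {\<omega> \<in> C. \<sigma> \<omega> \<le> t} = {\<omega> \<in> A \<inter> C. \<nu> \<omega> \<le> t}"
    using A(2) by auto
  finally show "{\<omega> \<in> A \<inter> C. \<nu> \<omega> \<le> t} \<in> sets (F t)" .
qed

text \<open>Meant for the event where the two times agree: there a variable known at the later time
  is already known at the earlier one.\<close>

lemma Linfty_indicator_eq_on:
  assumes "stopping_time F \<nu>" "stopping_time F \<sigma>"
    and A: "A \<in> sets (pre_sigma \<nu>)" "\<And>\<omega>. \<omega> \<in> A \<Longrightarrow> \<nu> \<omega> = \<sigma> \<omega>"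
    and W: "W \<in> Linfty M (pre_sigma \<sigma>)"
  shows "(\<lambda>\<omega>. indicator A \<omega> * W \<omega>) \<in> Linfty M (pre_sigma \<nu>)"
proof -
  obtain a where a: "W \<in> borel_measurable (pre_sigma \<sigma>)" "AE \<omega> in M. \<bar>W \<omega>\<bar> \<le> a"
    using W by (auto simp: Linfty_def)
  have "AE \<omega> in M. \<bar>indicator A \<omega> * W \<omega>\<bar> \<le> \<bar>a\<bar>"
    using a(2) by eventually_elim (auto simp: indicator_def)
  moreover have "(\<lambda>\<omega>. indicator A \<omega> * W \<omega>) \<in> borel_measurable (pre_sigma \<nu>)"
  proof (rule measurableI)
    fix B :: "real set" assume B: "B \<in> sets borel"
    have "A \<inter> (W -` B \<inter> space (pre_sigma \<sigma>)) \<in> sets (pre_sigma \<nu>)"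
      by (rule sets_pre_sigma_eq_on[OF assms(1,2) A measurable_sets[OF a(1) B]])
    \<comment> \<open>The product vanishes off \<open>A\<close>, so the complement belongs to the
      preimage exactly when \<open>B\<close> contains 0.\<close>
    then have "(A \<inter> (W -` B \<inter> space M)) \<union> (if 0 \<in> B then space M - A else {}) \<in> sets (pre_sigma \<nu>)"
      using A(1) sets.compl_sets[OF A(1)] by (auto simp: space_pre_sigma)
    also have "(A \<inter> (W -` B \<inter> space M)) \<union> (if 0 \<in> B then space M - A else {})
        = (\<lambda>\<omega>. indicator A \<omega> * W \<omega>) -` B \<inter> space (pre_sigma \<nu>)"
      by (auto simp: indicator_def of_bool_def space_pre_sigma split: if_splits)
    finally show "(\<lambda>\<omega>. indicator A \<omega> * W \<omega>) -` B \<inter> space (pre_sigma \<nu>) \<in> sets (pre_sigma \<nu>)" .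
  qed simp
  ultimately show ?thesis by (auto simp: Linfty_def)
qed

lemma Linfty_pre_sigma_mono:
  assumes "ordered_stopping_times M F \<sigma> \<tau>" "W \<in> Linfty M (pre_sigma \<sigma>)"
  shows "W \<in> Linfty M (pre_sigma \<tau>)"
proof -
  have "subalgebra (pre_sigma \<tau>) (pre_sigma \<sigma>)"
    using assms(1) mono_pre_sigma[of \<sigma> \<tau>]
    by (auto simp: subalgebra_def space_pre_sigma ordered_stopping_times_def)
  then show ?thesis using assms(2) measurable_from_subalg by (auto simp: Linfty_def)
qed

lemma Linfty_pre_sigma_measurable:
  "stopping_time F \<sigma> \<Longrightarrow> W \<in> Linfty M (pre_sigma \<sigma>) \<Longrightarrow> W \<in> borel_measurable M"
  using measurable_from_subalg[OF subalgebra_pre_sigma] by (auto simp: Linfty_def)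

text \<open>\<open>enn2real\<close> sends \<infinity> to 0, so this approximates \<sigma> only where
  \<sigma> is finite.\<close>

definition dyadic_time :: "nat \<Rightarrow> ('a \<Rightarrow> ennreal) \<Rightarrow> 'a \<Rightarrow> ennreal" where
  "dyadic_time n \<sigma> \<omega> = ennreal (dyadic_above n (enn2real (\<sigma> \<omega>)))"

lemma stopping_time_dyadic_time:
  assumes \<sigma>: "stopping_time F \<sigma>" and fin: "\<And>\<omega>. \<omega> \<in> space M \<Longrightarrow> \<sigma> \<omega> < \<infinity>"
  shows "stopping_time F (dyadic_time n \<sigma>)"
proof (rule stopping_timeI)
  fix t
  show "Measurable.pred (F t) (\<lambda>\<omega>. dyadic_time n \<sigma> \<omega> \<le> t)"
  proof (cases t)
    case (real r)
    \<comment> \<open>The last grid point up to \<open>r\<close>: whether \<sigma> lies strictly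
      below it is known at time \<open>?d\<close>, hence at \<open>r\<close>.\<close>
    let ?d = "of_int \<lfloor>r * 2 ^ n\<rfloor> / 2 ^ n :: real"
    have "of_int \<lfloor>r * 2 ^ n\<rfloor> \<le> r * 2 ^ n" by linarith
    then have d: "?d \<le> r" by (simp add: field_simps)
    have "dyadic_time n \<sigma> \<omega> \<le> t \<longleftrightarrow> \<sigma> \<omega> < ennreal ?d" if "\<omega> \<in> space M" for \<omega>
    proof -
      obtain x where x: "0 \<le> x" "\<sigma> \<omega> = ennreal x"
        using fin[OF \<open>\<omega> \<in> space M\<close>] by (cases "\<sigma> \<omega>") auto
      then show ?thesis
        using real by (simp add: dyadic_time_def ennreal_le_iff dyadic_above_le_iff ennreal_less_iff)
    qed
    then have "{\<omega> \<in> space M. dyadic_time n \<sigma> \<omega> \<le> t} = {\<omega> \<in> space M. \<sigma> \<omega> < ennreal ?d}"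
      by auto
    also have "\<dots> \<in> sets (F (ennreal ?d))"
      using stopping_time_less_const[OF \<sigma>, of "ennreal ?d"] by (simp add: pred_def space_F)
    also have "\<dots> \<subseteq> sets (F t)"
      using d real by (intro sets_F_mono) (simp add: ennreal_leI)
    finally show ?thesis by (simp add: pred_def space_F)
  qed simp
qed

text \<open>Dropping the first \<open>n\<close> terms shows that the limit is measurable for each
  \<open>pre_sigma (\<tau>s n)\<close>; right continuity carries this to \<tau>.\<close>

lemma borel_measurable_lim_pre_sigma:
  fixes f :: "nat \<Rightarrow> 'a \<Rightarrow> real"
  assumes \<tau>: "stopping_time F \<tau>" and \<tau>s: "\<And>n::nat. stopping_time F (\<tau>s n)"
    and lim: "\<And>\<omega>. \<omega> \<in> space M \<Longrightarrow> (\<lambda>n. \<tau>s n \<omega>) \<longlonglongrightarrow> \<tau> \<omega>"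
    and le: "\<And>\<omega> n. \<omega> \<in> space M \<Longrightarrow> \<tau> \<omega> \<le> \<tau>s n \<omega>"
    and dec: "\<And>\<omega> n m. \<omega> \<in> space M \<Longrightarrow> n \<le> m \<Longrightarrow> \<tau>s m \<omega> \<le> \<tau>s n \<omega>"
    and f: "\<And>n. f n \<in> borel_measurable (pre_sigma (\<tau>s n))"
  shows "(\<lambda>\<omega>. lim (\<lambda>n. f n \<omega>)) \<in> borel_measurable (pre_sigma \<tau>)"
proof (rule measurableI)
  fix B :: "real set" assume B: "B \<in> sets borel"
  show "(\<lambda>\<omega>. lim (\<lambda>n. f n \<omega>)) -` B \<inter> space (pre_sigma \<tau>) \<in> sets (pre_sigma \<tau>)"
  proof (rule sets_pre_sigma_right_continuous[OF \<tau> \<tau>s lim le])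
    fix n
    have "subalgebra (pre_sigma (\<tau>s n)) (pre_sigma (\<tau>s (k + n)))" for k
      using mono_pre_sigma[OF \<tau>s \<tau>s dec] by (simp add: subalgebra_def space_pre_sigma)
    then have "f (k + n) \<in> borel_measurable (pre_sigma (\<tau>s n))" for k
      using f by (rule measurable_from_subalg)
    then have "(\<lambda>\<omega>. lim (\<lambda>k. f (k + n) \<omega>)) \<in> borel_measurable (pre_sigma (\<tau>s n))"
      by (rule borel_measurable_lim_metric)
    then have "(\<lambda>\<omega>. lim (\<lambda>n. f n \<omega>)) \<in> borel_measurable (pre_sigma (\<tau>s n))"
      by (simp add: lim_shift[of "\<lambda>n. f n _"])
    from measurable_sets[OF this B]
    show "(\<lambda>\<omega>. lim (\<lambda>n. f n \<omega>)) -` B \<inter> space (pre_sigma \<tau>) \<in> sets (pre_sigma (\<tau>s n))"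
      by (simp add: space_pre_sigma)
  qed
qed simp

end

section \<open>The risk process\<close>

text \<open>Membership of \<open>Q\<close> supplies one half of the equivalence of the two measures,
  \<open>M_abs_Q\<close> the other. The bound \<open>c\<close> is fixed here because it serves as a
  truncation level later.\<close>

locale zero_penalty_risk = filtered_prob_space M F
  for M :: "'a measure" and F :: "ennreal \<Rightarrow> 'a measure" +
  fixes \<rho> :: "('a \<Rightarrow> ennreal) \<Rightarrow> ('a \<Rightarrow> ennreal) \<Rightarrow> ('a \<Rightarrow> real) \<Rightarrow> 'a \<Rightarrow> real"
    and T :: "'a \<Rightarrow> ennreal" and Q :: "'a measure" and X :: "'a \<Rightarrow> real"
    and c :: real
  assumes risk: "dynamic_risk_measure M F \<rho>"
    and norm: "normalized M F \<rho>"
    and cont: "continuous_from_above M F \<rho>"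
    and consistent: "time_consistent M F \<rho>"
    and T: "stopping_time F T"
    and Q: "Q \<in> zero_penalty_measures M F \<rho> T"
    and M_abs_Q: "absolutely_continuous Q M"
    and X: "X \<in> Linfty M (pre_sigma T)"
    and c_nonneg: "0 \<le> c" and X_bound: "AE \<omega> in M. \<bar>X \<omega>\<bar> \<le> c"
begin

abbreviation ordered :: "('a \<Rightarrow> ennreal) \<Rightarrow> ('a \<Rightarrow> ennreal) \<Rightarrow> bool" where
  "ordered \<equiv> ordered_stopping_times M F"

abbreviation L :: "('a \<Rightarrow> ennreal) \<Rightarrow> ('a \<Rightarrow> real) set" where
  "L \<sigma> \<equiv> Linfty M (pre_sigma \<sigma>)"

abbreviation U :: "('a \<Rightarrow> ennreal) \<Rightarrow> 'a \<Rightarrow> real" where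
  "U \<sigma> \<equiv> \<rho> \<sigma> T X"

lemma ordered_stop: "ordered \<sigma> \<tau> \<Longrightarrow> stopping_time F \<sigma>" "ordered \<sigma> \<tau> \<Longrightarrow> stopping_time F \<tau>"
  by (simp_all add: ordered_stopping_times_def)

lemma ordered_trans: "ordered \<nu> \<sigma> \<Longrightarrow> ordered \<sigma> \<tau> \<Longrightarrow> ordered \<nu> \<tau>"
  by (auto simp: ordered_stopping_times_def intro: order_trans)

section \<open>Rules for the risk measure: change of horizon, locality, bounds\<close>

lemma rho_L: "ordered \<sigma> \<tau> \<Longrightarrow> W \<in> L \<tau> \<Longrightarrow> \<rho> \<sigma> \<tau> W \<in> L \<sigma>"
  using risk unfolding dynamic_risk_measure_def by blast

lemma rho_antimono:
  "ordered \<sigma> \<tau> \<Longrightarrow> V \<in> L \<tau> \<Longrightarrow> W \<in> L \<tau> \<Longrightarrow> AE \<omega> in M. V \<omega> \<le> W \<omega> \<Longrightarrow> AE \<omega> in M. \<rho> \<sigma> \<tau> W \<omega> \<le> \<rho> \<sigma> \<tau> V \<omega>"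
  using risk unfolding dynamic_risk_measure_def by blast

lemma rho_translate:
  "ordered \<sigma> \<tau> \<Longrightarrow> W \<in> L \<tau> \<Longrightarrow> Z \<in> L \<sigma> \<Longrightarrow> AE \<omega> in M. \<rho> \<sigma> \<tau> (\<lambda>\<omega>. W \<omega> + Z \<omega>) \<omega> = \<rho> \<sigma> \<tau> W \<omega> - Z \<omega>"
  using risk unfolding dynamic_risk_measure_def by blast

lemma rho_zero: "ordered \<sigma> \<tau> \<Longrightarrow> AE \<omega> in M. \<rho> \<sigma> \<tau> (\<lambda>_. 0) \<omega> = 0"
  using norm unfolding normalized_def by blast

lemma rho_consistent:
  "ordered \<nu> \<sigma> \<Longrightarrow> ordered \<sigma> \<tau> \<Longrightarrow> W \<in> L \<tau> \<Longrightarrow> AE \<omega> in M. \<rho> \<nu> \<sigma> (\<lambda>\<omega>. - \<rho> \<sigma> \<tau> W \<omega>) \<omega> = \<rho> \<nu> \<tau> W \<omega>"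
  using consistent unfolding time_consistent_def by blast

lemma rho_cong:
  assumes "ordered \<sigma> \<tau>" "V \<in> L \<tau>" "W \<in> L \<tau>" "AE \<omega> in M. V \<omega> = W \<omega>"
  shows "AE \<omega> in M. \<rho> \<sigma> \<tau> V \<omega> = \<rho> \<sigma> \<tau> W \<omega>"
proof -
  have "AE \<omega> in M. V \<omega> \<le> W \<omega>" "AE \<omega> in M. W \<omega> \<le> V \<omega>"
    using assms(4) by auto
  from rho_antimono[OF assms(1,2,3) this(1)] rho_antimono[OF assms(1,3,2) this(2)]
  show ?thesis by eventually_elim simp
qed

lemma rho_measurable_arg:
  assumes "ordered \<sigma> \<tau>" "Z \<in> L \<sigma>"
  shows "AE \<omega> in M. \<rho> \<sigma> \<tau> Z \<omega> = - Z \<omega>"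
  using rho_translate[OF assms(1) Linfty_const assms(2), of 0] rho_zero[OF assms(1)] by auto

text \<open>Time consistency through \<tau>, where \<open>- \<rho> \<tau> S Z\<close> is
  \<open>Z\<close> itself.\<close>

lemma rho_extend:
  assumes "ordered \<sigma> \<tau>" "ordered \<tau> S" "Z \<in> L \<tau>"
  shows "AE \<omega> in M. \<rho> \<sigma> S Z \<omega> = \<rho> \<sigma> \<tau> Z \<omega>"
proof -
  have ZS: "Z \<in> L S" using assms(2,3) by (rule Linfty_pre_sigma_mono)
  have "AE \<omega> in M. - \<rho> \<tau> S Z \<omega> = Z \<omega>" using rho_measurable_arg[OF assms(2,3)] by auto
  with assms rho_L[OF assms(2) ZS]
  have "AE \<omega> in M. \<rho> \<sigma> \<tau> (\<lambda>\<omega>. - \<rho> \<tau> S Z \<omega>) \<omega> = \<rho> \<sigma> \<tau> Z \<omega>"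
    by (intro rho_cong Linfty_minus)
  with rho_consistent[OF assms(1,2) ZS] show ?thesis by auto
qed

text \<open>Adding a large constant to \<open>W\<close> off \<open>B\<close> makes it dominate
  \<open>V\<close>; by translation invariance this leaves the risk on \<open>B\<close>
  unchanged.\<close>

lemma rho_local_le:
  assumes "ordered \<sigma> \<tau>" "V \<in> L \<tau>" "W \<in> L \<tau>" "B \<in> sets (pre_sigma \<sigma>)"
    and eq: "AE \<omega> in M. \<omega> \<in> B \<longrightarrow> V \<omega> = W \<omega>"
  shows "AE \<omega> in M. \<omega> \<in> B \<longrightarrow> \<rho> \<sigma> \<tau> W \<omega> \<le> \<rho> \<sigma> \<tau> V \<omega>"
proof -
  obtain a b where ab: "AE \<omega> in M. \<bar>V \<omega>\<bar> \<le> a" "AE \<omega> in M. \<bar>W \<omega>\<bar> \<le> b"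
    using assms(2,3) by (auto simp: Linfty_def)
  let ?Z = "\<lambda>\<omega>. indicator (space M - B) \<omega> * (a + b)"
  have "space M - B \<in> sets (pre_sigma \<sigma>)"
    using sets.compl_sets[OF assms(4)] by (simp add: space_pre_sigma)
  then have Z: "?Z \<in> L \<sigma>" by (rule Linfty_indicator) (rule Linfty_const)
  have "AE \<omega> in M. V \<omega> \<le> W \<omega> + ?Z \<omega>"
    using ab eq AE_space by eventually_elim (auto simp: indicator_def)
  then have "AE \<omega> in M. \<rho> \<sigma> \<tau> (\<lambda>\<omega>. W \<omega> + ?Z \<omega>) \<omega> \<le> \<rho> \<sigma> \<tau> V \<omega>"
    using assms(1-3) Linfty_pre_sigma_mono[OF assms(1) Z] by (intro rho_antimono Linfty_add)
  with rho_translate[OF assms(1,3) Z] show ?thesis by eventually_elim auto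
qed

lemma rho_local:
  assumes "ordered \<sigma> \<tau>" "V \<in> L \<tau>" "W \<in> L \<tau>" "B \<in> sets (pre_sigma \<sigma>)"
    and eq: "AE \<omega> in M. \<omega> \<in> B \<longrightarrow> V \<omega> = W \<omega>"
  shows "AE \<omega> in M. \<omega> \<in> B \<longrightarrow> \<rho> \<sigma> \<tau> V \<omega> = \<rho> \<sigma> \<tau> W \<omega>"
proof -
  have "AE \<omega> in M. \<omega> \<in> B \<longrightarrow> W \<omega> = V \<omega>" using eq by auto
  from rho_local_le[OF assms(1,3,2,4) this] rho_local_le[OF assms] show ?thesis
    by eventually_elim auto
qed

lemma sets_pre_sigma_trans: "ordered \<sigma> \<tau> \<Longrightarrow> A \<in> sets (pre_sigma \<sigma>) \<Longrightarrow> A \<in> sets (pre_sigma \<tau>)"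
  using mono_pre_sigma[of \<sigma> \<tau>] by (auto simp: ordered_stopping_times_def)

lemma rho_indicator:
  assumes "ordered \<sigma> \<tau>" "W \<in> L \<tau>" "A \<in> sets (pre_sigma \<sigma>)"
  shows "AE \<omega> in M. \<rho> \<sigma> \<tau> (\<lambda>\<omega>. indicator A \<omega> * W \<omega>) \<omega> = indicator A \<omega> * \<rho> \<sigma> \<tau> W \<omega>"
proof -
  have AW: "(\<lambda>\<omega>. indicator A \<omega> * W \<omega>) \<in> L \<tau>"
    using sets_pre_sigma_trans[OF assms(1,3)] assms(2) by (rule Linfty_indicator)
  have cA: "space M - A \<in> sets (pre_sigma \<sigma>)"
    using sets.compl_sets[OF assms(3)] by (simp add: space_pre_sigma)
  have "AE \<omega> in M. \<omega> \<in> A \<longrightarrow> \<rho> \<sigma> \<tau> (\<lambda>\<omega>. indicator A \<omega> * W \<omega>) \<omega> = \<rho> \<sigma> \<tau> W \<omega>"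
    by (rule rho_local[OF assms(1) AW assms(2,3)]) auto
  moreover have "AE \<omega> in M. \<omega> \<in> space M - A \<longrightarrow>
      \<rho> \<sigma> \<tau> (\<lambda>\<omega>. indicator A \<omega> * W \<omega>) \<omega> = \<rho> \<sigma> \<tau> (\<lambda>_. 0) \<omega>"
    by (rule rho_local[OF assms(1) AW Linfty_const cA]) auto
  ultimately show ?thesis
    using rho_zero[OF assms(1)] AE_space by eventually_elim (auto simp: indicator_def)
qed

lemma rho_bound:
  assumes "ordered \<sigma> \<tau>" "W \<in> L \<tau>" "AE \<omega> in M. \<bar>W \<omega>\<bar> \<le> a"
  shows "AE \<omega> in M. \<bar>\<rho> \<sigma> \<tau> W \<omega>\<bar> \<le> a"
proof -
  have "AE \<omega> in M. W \<omega> \<le> a" "AE \<omega> in M. - a \<le> W \<omega>" using assms(3) by auto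
  from rho_antimono[OF assms(1,2) Linfty_const this(1)] rho_antimono[OF assms(1) Linfty_const assms(2) this(2)]
    rho_measurable_arg[OF assms(1) Linfty_const, of a] rho_measurable_arg[OF assms(1) Linfty_const, of "- a"]
  show ?thesis by eventually_elim auto
qed

text \<open>The only use of continuity from above.  With \<open>B\<^sub>n = \<Union>\<^bsub>k\<ge>n\<^esub> A\<^sub>k\<^sup>c\<close> the variables
  \<open>W + b 1\<^bsub>B\<^sub>n\<^esub>\<close> decrease to \<open>W\<close> and dominate \<open>1\<^bsub>A\<^sub>n\<^esub> W\<close>.\<close>

lemma rho_le_of_eventually:
  fixes A :: "nat \<Rightarrow> 'a set"
  assumes o: "ordered \<sigma> \<tau>" and W: "W \<in> L \<tau>" and A: "\<And>n. A n \<in> sets (pre_sigma \<tau>)"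
    and ev: "AE \<omega> in M. \<forall>\<^sub>F n in sequentially. \<omega> \<in> A n"
    and le: "\<And>n. AE \<omega> in M. \<rho> \<sigma> \<tau> (\<lambda>\<omega>. indicator (A n) \<omega> * W \<omega>) \<omega> \<le> e"
  shows "AE \<omega> in M. \<rho> \<sigma> \<tau> W \<omega> \<le> e"
proof -
  obtain b where b: "AE \<omega> in M. \<bar>W \<omega>\<bar> \<le> b" using W by (auto simp: Linfty_def)
  define B where "B n = (\<Union>k\<in>{n..}. space M - A k)" for n
  have cA: "space M - A n \<in> sets (pre_sigma \<tau>)" for n
    using sets.compl_sets[OF A[of n]] by (simp add: space_pre_sigma)
  have B: "B n \<in> sets (pre_sigma \<tau>)" for n
    unfolding B_def using cA by (intro sets.countable_UN') auto
  define V where "V n \<omega> = W \<omega> + indicator (B n) \<omega> * \<bar>b\<bar>" for n \<omega>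
  have V: "V n \<in> L \<tau>" for n
    unfolding V_def by (intro Linfty_add W Linfty_indicator B Linfty_const)
  have "decseq (\<lambda>n. V n \<omega>)" for \<omega>
    unfolding decseq_def V_def B_def by (auto simp: indicator_def)
  moreover have "AE \<omega> in M. (\<lambda>n. V n \<omega>) \<longlonglongrightarrow> W \<omega>"
    using ev
  proof eventually_elim
    case (elim \<omega>)
    then obtain N where "\<And>n. N \<le> n \<Longrightarrow> \<omega> \<in> A n" by (auto simp: eventually_sequentially)
    then have "V n \<omega> = W \<omega>" if "N \<le> n" for n
      using that by (auto simp: V_def B_def indicator_def)
    then show ?case by (intro tendsto_eventually) (auto simp: eventually_sequentially)
  qed
  ultimately have "AE \<omega> in M. decseq (\<lambda>n. V n \<omega>) \<and> (\<lambda>n. V n \<omega>) \<longlonglongrightarrow> W \<omega>" by auto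
  then have lim: "AE \<omega> in M. incseq (\<lambda>n. \<rho> \<sigma> \<tau> (V n) \<omega>) \<and> (\<lambda>n. \<rho> \<sigma> \<tau> (V n) \<omega>) \<longlonglongrightarrow> \<rho> \<sigma> \<tau> W \<omega>"
    using cont o W V unfolding continuous_from_above_def by blast
  have "AE \<omega> in M. \<rho> \<sigma> \<tau> (V n) \<omega> \<le> e" for n
  proof -
    \<comment> \<open>Off \<open>A n\<close> the point lies in \<open>B n\<close>, where
      \<open>V n\<close> is \<open>W + \<bar>b\<bar>\<close> and hence nonnegative.\<close>
    have "AE \<omega> in M. indicator (A n) \<omega> * W \<omega> \<le> V n \<omega>"
      using b AE_space by eventually_elim (auto simp: V_def B_def indicator_def)
    then have "AE \<omega> in M. \<rho> \<sigma> \<tau> (V n) \<omega> \<le> \<rho> \<sigma> \<tau> (\<lambda>\<omega>. indicator (A n) \<omega> * W \<omega>) \<omega>"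
      by (rule rho_antimono[OF o Linfty_indicator[OF A W] V])
    with le[of n] show ?thesis by eventually_elim simp
  qed
  then have "AE \<omega> in M. \<forall>n. \<rho> \<sigma> \<tau> (V n) \<omega> \<le> e" by (simp add: AE_all_countable)
  with lim show ?thesis by eventually_elim (auto intro: LIMSEQ_le_const2)
qed

section \<open>Passing between the two measures, and the supermartingale inequality\<close>

lemma prob_space_Q: "prob_space Q" and sets_Q: "sets Q = sets M" and Q_abs_M: "absolutely_continuous M Q"
  using Q by (auto simp: zero_penalty_measures_def)

lemma space_Q: "space Q = space M"
  using sets_Q by (rule sets_eq_imp_space_eq)

lemma AE_Q: "AE \<omega> in M. P \<omega> \<Longrightarrow> AE \<omega> in Q. P \<omega>"
  by (rule absolutely_continuous_AE[OF sets_Q Q_abs_M])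

lemma AE_M: "AE \<omega> in Q. P \<omega> \<Longrightarrow> AE \<omega> in M. P \<omega>"
  by (rule absolutely_continuous_AE[OF sets_Q[symmetric] M_abs_Q])

lemma subalgebra_Q: "subalgebra M G \<Longrightarrow> subalgebra Q G"
  by (simp add: subalgebra_def sets_Q space_Q)

lemma borel_measurable_Q: "f \<in> borel_measurable M \<Longrightarrow> f \<in> borel_measurable Q"
  using measurable_cong_sets[OF sets_Q refl] by blast

lemma integrable_Q:
  assumes "stopping_time F \<sigma>" "W \<in> L \<sigma>"
  shows "integrable Q W"
proof -
  interpret Q: prob_space Q by (rule prob_space_Q)
  obtain b where b: "AE \<omega> in M. \<bar>W \<omega>\<bar> \<le> b" using assms(2) by (auto simp: Linfty_def)
  have "W \<in> borel_measurable Q"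
    using Linfty_pre_sigma_measurable[OF assms] by (rule borel_measurable_Q)
  then show ?thesis using AE_Q[OF b] by (intro Q.integrable_const_bound[of _ b]) auto
qed

lemma ordered_zero: "ordered (\<lambda>_. 0) \<sigma>" if "stopping_time F \<sigma>"
  using that by (simp add: ordered_stopping_times_def stopping_time_const)

text \<open>Zero dominates all penalties, so the conditional expectation of \<open>- W\<close> at
  time 0 is at most the risk of \<open>W\<close>, which is 0; integrate.\<close>

lemma expectation_nonneg:
  assumes W: "W \<in> L T" and zero: "AE \<omega> in M. \<rho> (\<lambda>_. 0) T W \<omega> = 0"
  shows "0 \<le> (\<integral>\<omega>. W \<omega> \<partial>Q)"
proof -
  interpret Q: prob_space Q by (rule prob_space_Q)
  let ?G = "pre_sigma (\<lambda>_. 0)"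
  interpret finite_measure_subalgebra Q ?G
    by unfold_locales (rule subalgebra_Q[OF subalgebra_pre_sigma[OF stopping_time_const]])
  let ?pen = "\<lambda>V \<omega>. ereal (real_cond_exp Q ?G (\<lambda>\<omega>'. - V \<omega>') \<omega> - \<rho> (\<lambda>_. 0) T V \<omega>)"
  have "\<forall>f\<in>?pen ` L T. AE \<omega> in Q. f \<omega> \<le> 0"
    using Q unfolding zero_penalty_measures_def is_min_penalty_def is_ess_sup_def mem_Collect_eq
    by (elim conjE)
  from bspec[OF this imageI[OF W]]
  have "AE \<omega> in Q. ereal (real_cond_exp Q ?G (\<lambda>\<omega>. - W \<omega>) \<omega> - \<rho> (\<lambda>_. 0) T W \<omega>) \<le> 0" .
  with AE_Q[OF zero] have le: "AE \<omega> in Q. real_cond_exp Q ?G (\<lambda>\<omega>. - W \<omega>) \<omega> \<le> 0"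
    by eventually_elim simp
  have int: "integrable Q (\<lambda>\<omega>. - W \<omega>)" using integrable_Q[OF T W] by simp
  have "- (\<integral>\<omega>. W \<omega> \<partial>Q) = (\<integral>\<omega>. real_cond_exp Q ?G (\<lambda>\<omega>. - W \<omega>) \<omega> \<partial>Q)"
    using real_cond_exp_int(2)[OF int] by simp
  also have "\<dots> \<le> (\<integral>\<omega>. 0 \<partial>Q)"
    using le by (intro integral_mono_AE real_cond_exp_int(1) int) auto
  finally show ?thesis by simp
qed

lemma U_L: "ordered \<sigma> T \<Longrightarrow> U \<sigma> \<in> L \<sigma>"
  using X by (intro rho_L)

lemma integral_U_antimono:
  assumes o: "ordered \<sigma> \<tau>" "ordered \<tau> T" and A: "A \<in> sets (pre_sigma \<sigma>)"
  shows "(\<integral>\<omega>. indicator A \<omega> * U \<tau> \<omega> \<partial>Q) \<le> (\<integral>\<omega>. indicator A \<omega> * U \<sigma> \<omega> \<partial>Q)"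
proof -
  have oT: "ordered \<sigma> T" using o by (rule ordered_trans)
  note stop = ordered_stop[OF o(1)]
  note o0 = ordered_zero[OF stop(1)]
  have A\<tau>: "A \<in> sets (pre_sigma \<tau>)" using o(1) A by (rule sets_pre_sigma_trans)
  have U\<sigma>: "U \<sigma> \<in> L \<sigma>" and U\<tau>: "U \<tau> \<in> L \<tau>" using o(2) oT by (auto intro: U_L)
  let ?D = "\<lambda>\<omega>. - U \<tau> \<omega> + U \<sigma> \<omega>"
  have D\<tau>: "?D \<in> L \<tau>" using U\<tau> Linfty_pre_sigma_mono[OF o(1) U\<sigma>] by (intro Linfty_add Linfty_minus)
  let ?W = "\<lambda>\<omega>. indicator A \<omega> * ?D \<omega>"
  have W\<tau>: "?W \<in> L \<tau>" using A\<tau> D\<tau> by (rule Linfty_indicator)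
  then have WT: "?W \<in> L T" by (rule Linfty_pre_sigma_mono[OF o(2)])
  \<comment> \<open>The translation by \<open>U \<sigma>\<close> cancels this risk, so
    \<open>?D\<close> has risk zero at \<sigma>. \<open>rho_indicator\<close> and
    \<open>rho_extend\<close> carry that to \<open>?W\<close> with horizon \<open>T\<close>.\<close>
  have "AE \<omega> in M. \<rho> \<sigma> \<tau> (\<lambda>\<omega>. - U \<tau> \<omega>) \<omega> = U \<sigma> \<omega>"
    by (rule rho_consistent[OF o X])
  with rho_translate[OF o(1) Linfty_minus[OF U\<tau>] U\<sigma>] rho_indicator[OF o(1) D\<tau> A]
    rho_extend[OF o W\<tau>]
  have "AE \<omega> in M. - \<rho> \<sigma> T ?W \<omega> = 0" by eventually_elim simp
  \<comment> \<open>Time consistency through \<sigma> brings the vanishing risk down to time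
    0.\<close>
  then have "AE \<omega> in M. \<rho> (\<lambda>_. 0) \<sigma> (\<lambda>\<omega>. - \<rho> \<sigma> T ?W \<omega>) \<omega> = \<rho> (\<lambda>_. 0) \<sigma> (\<lambda>_. 0) \<omega>"
    by (intro rho_cong o0 Linfty_minus rho_L[OF oT WT] Linfty_const)
  with rho_consistent[OF o0 oT WT] rho_zero[OF o0]
  have "AE \<omega> in M. \<rho> (\<lambda>_. 0) T ?W \<omega> = 0" by eventually_elim simp
  then have "0 \<le> (\<integral>\<omega>. ?W \<omega> \<partial>Q)" by (rule expectation_nonneg[OF WT])
  also have "(\<lambda>\<omega>. ?W \<omega>) = (\<lambda>\<omega>. indicator A \<omega> * U \<sigma> \<omega> - indicator A \<omega> * U \<tau> \<omega>)"
    by (simp add: algebra_simps)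
  also have "(\<integral>\<omega>. \<dots> \<omega> \<partial>Q) = (\<integral>\<omega>. indicator A \<omega> * U \<sigma> \<omega> \<partial>Q) - (\<integral>\<omega>. indicator A \<omega> * U \<tau> \<omega> \<partial>Q)"
    using integrable_Q[OF stop(1) Linfty_indicator[OF A U\<sigma>]] integrable_Q[OF stop(2) Linfty_indicator[OF A\<tau> U\<tau>]]
    by (rule Bochner_Integration.integral_diff)
  finally show ?thesis by simp
qed

text \<open>On the event where the times agree, \<open>- U \<sigma>\<close> is already known at
  \<nu>, so by locality its risk there is \<open>U \<sigma>\<close>; by time consistency it is also
  \<open>U \<nu>\<close>.\<close>

lemma U_eq_on:
  assumes o: "ordered \<nu> \<sigma>" "ordered \<sigma> T"
  shows "AE \<omega> in M. \<nu> \<omega> = \<sigma> \<omega> \<longrightarrow> U \<nu> \<omega> = U \<sigma> \<omega>"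
proof -
  note stop = ordered_stop[OF o(1)]
  define A where "A = {\<omega> \<in> space M. \<nu> \<omega> = \<sigma> \<omega>}"
  have "{\<omega> \<in> space M. \<nu> \<omega> < \<sigma> \<omega>} \<in> sets (pre_sigma \<nu>)"
    using stopping_time_less[OF stop] by (simp add: pred_def space_pre_sigma)
  then have "space M - {\<omega> \<in> space M. \<nu> \<omega> < \<sigma> \<omega>} \<in> sets (pre_sigma \<nu>)"
    using sets.compl_sets by (fastforce simp: space_pre_sigma)
  also have "space M - {\<omega> \<in> space M. \<nu> \<omega> < \<sigma> \<omega>} = A"
    using o(1) by (auto simp: A_def ordered_stopping_times_def order.order_iff_strict)
  finally have A: "A \<in> sets (pre_sigma \<nu>)" .
  have U\<sigma>: "U \<sigma> \<in> L \<sigma>" using o(2) by (rule U_L)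
  let ?Z = "\<lambda>\<omega>. indicator A \<omega> * (- U \<sigma> \<omega>)"
  have Z: "?Z \<in> L \<nu>"
    by (rule Linfty_indicator_eq_on[OF stop A _ Linfty_minus[OF U\<sigma>]]) (simp add: A_def)
  have "AE \<omega> in M. \<omega> \<in> A \<longrightarrow> \<rho> \<nu> \<sigma> (\<lambda>\<omega>. - U \<sigma> \<omega>) \<omega> = \<rho> \<nu> \<sigma> ?Z \<omega>"
    by (rule rho_local[OF o(1) Linfty_minus[OF U\<sigma>] Linfty_pre_sigma_mono[OF o(1) Z] A]) auto
  with rho_measurable_arg[OF o(1) Z] rho_consistent[OF o X] AE_space show ?thesis
    by eventually_elim (auto simp: A_def)
qed

text \<open>On \<open>A\<^sub>n = {U \<tau>\<^sub>n \<le> l + e}\<close> time consistency gives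
  \<open>\<rho>\<^bsub>\<tau>,T\<^esub>(1\<^bsub>A\<^sub>n\<^esub> (X + l)) = \<rho>\<^bsub>\<tau>,\<tau>\<^sub>n\<^esub>(1\<^bsub>A\<^sub>n\<^esub> (l - U \<tau>\<^sub>n)) \<le> e\<close>, and the events \<open>A\<^sub>n\<close> exhaust the
  space.\<close>

lemma U_le_limit:
  assumes o: "\<And>n::nat. ordered \<tau> (\<tau>s n)" "\<And>n. ordered (\<tau>s n) T"
    and l: "l \<in> L \<tau>" and lim: "AE \<omega> in M. (\<lambda>n. U (\<tau>s n) \<omega>) \<longlonglongrightarrow> l \<omega>"
  shows "AE \<omega> in M. U \<tau> \<omega> \<le> l \<omega>"
proof -
  have oT: "ordered \<tau> T" using o by (rule ordered_trans)
  have lT: "l \<in> L T" using oT l by (rule Linfty_pre_sigma_mono)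
  have l\<tau>s: "l \<in> L (\<tau>s n)" for n using o(1) l by (rule Linfty_pre_sigma_mono)
  let ?W = "\<lambda>\<omega>. X \<omega> + l \<omega>"
  have W: "?W \<in> L T" using X lT by (rule Linfty_add)
  have *: "AE \<omega> in M. U \<tau> \<omega> - l \<omega> \<le> e" if e: "0 < e" for e
  proof -
    define A where "A n = {\<omega> \<in> space M. U (\<tau>s n) \<omega> \<le> l \<omega> + e}" for n
    have A: "A n \<in> sets (pre_sigma (\<tau>s n))" for n
    proof -
      have [measurable]: "U (\<tau>s n) \<in> borel_measurable (pre_sigma (\<tau>s n))" "l \<in> borel_measurable (pre_sigma (\<tau>s n))"
        using U_L[OF o(2)] l\<tau>s by (auto simp: Linfty_def)
      have "{\<omega> \<in> space (pre_sigma (\<tau>s n)). U (\<tau>s n) \<omega> \<le> l \<omega> + e} \<in> sets (pre_sigma (\<tau>s n))"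
        by measurable
      then show ?thesis by (simp add: A_def space_pre_sigma)
    qed
    have "AE \<omega> in M. \<rho> \<tau> T ?W \<omega> \<le> e"
    proof (rule rho_le_of_eventually[OF oT W])
      show "A n \<in> sets (pre_sigma T)" for n using o(2) A by (rule sets_pre_sigma_trans)
      show "AE \<omega> in M. \<forall>\<^sub>F n in sequentially. \<omega> \<in> A n"
        using lim AE_space
      proof eventually_elim
        case (elim \<omega>)
        have "\<forall>\<^sub>F n in sequentially. U (\<tau>s n) \<omega> < l \<omega> + e"
          using elim(1) e by (intro order_tendstoD) auto
        then show ?case by (rule eventually_mono) (use elim(2) in \<open>auto simp: A_def\<close>)
      qed
      fix n
      let ?V = "\<lambda>\<omega>. indicator (A n) \<omega> * ?W \<omega>"
      have V: "?V \<in> L T"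
        using sets_pre_sigma_trans[OF o(2) A] W by (rule Linfty_indicator)
      \<comment> \<open>The risk of \<open>?V\<close> is \<open>U (\<tau>s n) - l\<close> on
        \<open>A n\<close> and 0 elsewhere, hence at most \<open>e\<close> by the choice of
        \<open>A n\<close>.\<close>
      have "AE \<omega> in M. - e \<le> - \<rho> (\<tau>s n) T ?V \<omega>"
        using rho_indicator[OF o(2) W A, of n] rho_translate[OF o(2) X l\<tau>s, of n]
        by eventually_elim (use e in \<open>auto simp: A_def indicator_def\<close>)
      then have "AE \<omega> in M. \<rho> \<tau> (\<tau>s n) (\<lambda>\<omega>. - \<rho> (\<tau>s n) T ?V \<omega>) \<omega> \<le> \<rho> \<tau> (\<tau>s n) (\<lambda>_. - e) \<omega>"
        by (intro rho_antimono o Linfty_const Linfty_minus rho_L V)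
      with rho_consistent[OF o V, of n] rho_measurable_arg[OF o(1) Linfty_const, of n "- e"]
      show "AE \<omega> in M. \<rho> \<tau> T ?V \<omega> \<le> e" by eventually_elim simp
    qed
    with rho_translate[OF oT X l] show ?thesis by eventually_elim simp
  qed
  have "AE \<omega> in M. \<forall>k. U \<tau> \<omega> - l \<omega> \<le> 1 / real (Suc k)"
    unfolding AE_all_countable by (intro allI *) simp
  then show ?thesis
  proof eventually_elim
    case (elim \<omega>)
    have "U \<tau> \<omega> - l \<omega> \<le> 0"
      by (rule LIMSEQ_le_const[OF LIMSEQ_inverse_real_of_nat])
        (use elim in \<open>simp add: inverse_eq_divide\<close>)
    then show ?case by simp
  qed
qed

text \<open>\<open>U_le_limit\<close> gives one inequality pointwise, the supermartingale property
  the other one in expectation; together they force equality.\<close>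

lemma U_eq_limit:
  assumes o: "\<And>n::nat. ordered \<tau> (\<tau>s n)" "\<And>n. ordered (\<tau>s n) T"
    and l: "l \<in> L \<tau>" and lim: "AE \<omega> in M. (\<lambda>n. U (\<tau>s n) \<omega>) \<longlonglongrightarrow> l \<omega>"
  shows "AE \<omega> in M. U \<tau> \<omega> = l \<omega>"
proof -
  interpret Q: prob_space Q by (rule prob_space_Q)
  have oT: "ordered \<tau> T" using o by (rule ordered_trans)
  note \<tau> = ordered_stop(1)[OF oT]
  have meas: "U (\<tau>s n) \<in> borel_measurable Q" for n
    using Linfty_pre_sigma_measurable[OF ordered_stop(1)[OF o(2)] U_L[OF o(2)]] by (rule borel_measurable_Q)
  have int: "integrable Q l" "integrable Q (U \<tau>)"
    using integrable_Q[OF \<tau> l] integrable_Q[OF \<tau> U_L[OF oT]] by auto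
  have space: "space M \<in> sets (pre_sigma \<tau>)"
    using sets.top[of "pre_sigma \<tau>"] by (simp add: space_pre_sigma)
  have ind:  "(\<integral>\<omega>. indicator (space M) \<omega> * f \<omega> \<partial>Q) = (\<integral>\<omega>. f \<omega> \<partial>Q)" for f :: "'a \<Rightarrow> real"
    by (rule Bochner_Integration.integral_cong) (auto simp: space_Q)
  have "(\<integral>\<omega>. U (\<tau>s n) \<omega> \<partial>Q) \<le> (\<integral>\<omega>. U \<tau> \<omega> \<partial>Q)" for n
    using integral_U_antimono[OF o space] unfolding ind .
  moreover have "(\<lambda>n. \<integral>\<omega>. U (\<tau>s n) \<omega> \<partial>Q) \<longlonglongrightarrow> (\<integral>\<omega>. l \<omega> \<partial>Q)"
  proof (rule integral_dominated_convergence[where w = "\<lambda>_. c"])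
    show "AE \<omega> in Q. norm (U (\<tau>s n) \<omega>) \<le> c" for n
      using AE_Q[OF rho_bound[OF o(2) X X_bound]] by simp
  qed (use AE_Q[OF lim] meas int in auto)
  ultimately have "(\<integral>\<omega>. l \<omega> \<partial>Q) \<le> (\<integral>\<omega>. U \<tau> \<omega> \<partial>Q)"
    by (intro LIMSEQ_le_const2) auto
  then have "(\<integral>\<omega>. l \<omega> - U \<tau> \<omega> \<partial>Q) \<le> 0" using int by simp
  moreover have nn: "AE \<omega> in Q. 0 \<le> l \<omega> - U \<tau> \<omega>"
    using AE_Q[OF U_le_limit[OF assms]] by auto
  then have "0 \<le> (\<integral>\<omega>. l \<omega> - U \<tau> \<omega> \<partial>Q)" by (rule integral_nonneg_AE)
  ultimately have "(\<integral>\<omega>. l \<omega> - U \<tau> \<omega> \<partial>Q) = 0" by (rule antisym)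
  then have "AE \<omega> in Q. l \<omega> - U \<tau> \<omega> = 0"
    using integral_nonneg_eq_0_iff_AE[OF Bochner_Integration.integrable_diff[OF int] nn] by blast
  then have "AE \<omega> in M. l \<omega> - U \<tau> \<omega> = 0" by (rule AE_M)
  then show ?thesis by eventually_elim simp
qed

section \<open>The risk process stopped at \<open>T\<close> and its cadlag version\<close>

abbreviation stopped :: "('a \<Rightarrow> ennreal) \<Rightarrow> 'a \<Rightarrow> ennreal" where
  "stopped \<sigma> \<equiv> \<lambda>\<omega>. min (\<sigma> \<omega>) (T \<omega>)"

lemma ordered_stopped: "stopping_time F \<sigma> \<Longrightarrow> ordered (stopped \<sigma>) T"
  using T by (auto simp: ordered_stopping_times_def intro: stopping_time_min)

lemma ordered_stopped_mono:
  "stopping_time F \<sigma> \<Longrightarrow> stopping_time F \<tau> \<Longrightarrow> (\<And>\<omega>. \<omega> \<in> space M \<Longrightarrow> \<sigma> \<omega> \<le> \<tau> \<omega>) \<Longrightarrow>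
    ordered (stopped \<sigma>) (stopped \<tau>)"
  using T by (auto simp: ordered_stopping_times_def intro: stopping_time_min min.coboundedI1)

text \<open>Two unordered times are compared through their minimum.\<close>

lemma U_eq:
  assumes "ordered \<sigma> T" "ordered \<tau> T"
  shows "AE \<omega> in M. \<sigma> \<omega> = \<tau> \<omega> \<longrightarrow> U \<sigma> \<omega> = U \<tau> \<omega>"
proof -
  let ?\<nu> = "\<lambda>\<omega>. min (\<sigma> \<omega>) (\<tau> \<omega>)"
  have "ordered ?\<nu> \<sigma>" "ordered ?\<nu> \<tau>"
    using assms by (auto simp: ordered_stopping_times_def intro: stopping_time_min)
  from U_eq_on[OF this(1) assms(1)] U_eq_on[OF this(2) assms(2)] show ?thesis
    by eventually_elim auto
qed

text \<open>An event of \<open>F s\<close> need not be known at time \<open>min s T\<close>. On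
  \<open>T <= s\<close> both stopped times equal \<open>T\<close> and the two sides agree; the
  remaining part \<open>B\<close> is known at \<open>min s T\<close>.\<close>

lemma integral_U_stopped_antimono:
  assumes "s \<le> t" and A: "A \<in> sets (F s)"
  shows "(\<integral>\<omega>. indicator A \<omega> * U (stopped (\<lambda>_. t)) \<omega> \<partial>Q) \<le> (\<integral>\<omega>. indicator A \<omega> * U (stopped (\<lambda>_. s)) \<omega> \<partial>Q)"
proof -
  let ?s = "stopped (\<lambda>_. s)" and ?t = "stopped (\<lambda>_. t)"
  have os: "ordered ?s T" and ot: "ordered ?t T" by (auto intro: ordered_stopped stopping_time_const)
  have ost: "ordered ?s ?t" using assms(1) by (intro ordered_stopped_mono stopping_time_const)
  have A_space: "A \<subseteq> space M" using sets.sets_into_space[OF A] by (simp add: space_F)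
  define B where "B = {\<omega> \<in> A. s < T \<omega>}"
  have "A - {\<omega> \<in> space M. T \<omega> \<le> s} \<in> sets (F s)"
    using A stopping_time_sets[OF T] by (rule sets.Diff)
  also have "A - {\<omega> \<in> space M. T \<omega> \<le> s} = B"
    using A_space by (auto simp: B_def not_le)
  finally have BF: "B \<in> sets (F s)" .
  have B: "B \<in> sets (pre_sigma ?s)"
  proof (rule sets_pre_sigmaI[OF ordered_stop(1)[OF os]])
    fix u
    \<comment> \<open>On \<open>B\<close> the minimum is \<open>s\<close>, so the event is all or
      nothing.\<close>
    have "{\<omega> \<in> B. min s (T \<omega>) \<le> u} = (if s \<le> u then B else {})"
      by (auto simp: B_def min_le_iff_disj)
    then show "{\<omega> \<in> B. min s (T \<omega>) \<le> u} \<in> sets (F u)" using BF sets_F_mono by auto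
  qed
  have int: "integrable Q (\<lambda>\<omega>. indicator C \<omega> * U \<sigma> \<omega>)" if "C \<in> sets M" "ordered \<sigma> T" for C \<sigma>
    using integrable_mult_indicator[of C Q "U \<sigma>"] integrable_Q[OF ordered_stop(1)[OF that(2)] U_L[OF that(2)]]
      that(1) by (simp add: sets_Q)
  have AM: "A \<in> sets M" and BM: "B \<in> sets M" using A BF sets_F_subset by auto
  have "AE \<omega> in M. indicator A \<omega> * U ?t \<omega> - indicator A \<omega> * U ?s \<omega>
      = indicator B \<omega> * U ?t \<omega> - indicator B \<omega> * U ?s \<omega>"
    using U_eq[OF os ot]
  proof eventually_elim
    case (elim \<omega>)
    show ?case
    proof (cases "\<omega> \<in> A - B")
      case True
      then have "T \<omega> \<le> s" by (auto simp: B_def)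
      then have "min s (T \<omega>) = min t (T \<omega>)" using assms(1) by (simp add: min_absorb2)
      then have "U ?s \<omega> = U ?t \<omega>" using elim by simp
      then show ?thesis by (simp add: indicator_def)
    qed (auto simp: B_def indicator_def)
  qed
  then have "(\<integral>\<omega>. indicator A \<omega> * U ?t \<omega> - indicator A \<omega> * U ?s \<omega> \<partial>Q)
      = (\<integral>\<omega>. indicator B \<omega> * U ?t \<omega> - indicator B \<omega> * U ?s \<omega> \<partial>Q)"
    using int AM BM os ot by (intro integral_cong_AE AE_Q borel_measurable_diff borel_measurable_integrable)
  also have "\<dots> = (\<integral>\<omega>. indicator B \<omega> * U ?t \<omega> \<partial>Q) - (\<integral>\<omega>. indicator B \<omega> * U ?s \<omega> \<partial>Q)"
    by (intro Bochner_Integration.integral_diff int BM os ot)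
  also have "\<dots> \<le> 0" using integral_U_antimono[OF ost ot B] by simp
  finally show ?thesis
    by (subst (asm) Bochner_Integration.integral_diff) (auto intro!: int AM os ot)
qed

text \<open>Clipping changes nothing almost everywhere but makes the bound \<open>c\<close> hold at
  every point, as \<open>AE_tame_on_dyadics\<close> demands.\<close>

definition V :: "real \<Rightarrow> 'a \<Rightarrow> real" where
  "V t \<omega> = max (- c) (min c (U (stopped (\<lambda>_. ennreal t)) \<omega>))"

lemma abs_V_le: "\<bar>V t \<omega>\<bar> \<le> c"
  using c_nonneg by (auto simp: V_def)

lemma AE_V_eq: "AE \<omega> in M. V t \<omega> = U (stopped (\<lambda>_. ennreal t)) \<omega>"
  using rho_bound[OF ordered_stopped[OF stopping_time_const] X X_bound, of "ennreal t"]
  by eventually_elim (auto simp: V_def)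

lemma V_measurable_F: "V t \<in> borel_measurable (F (ennreal t))"
proof -
  let ?t = "stopped (\<lambda>_. ennreal t)"
  have "ordered ?t T" by (rule ordered_stopped[OF stopping_time_const])
  then have U: "U ?t \<in> borel_measurable (pre_sigma ?t)" "stopping_time F ?t"
    using U_L ordered_stop by (auto simp: Linfty_def)
  have "sets (pre_sigma ?t) \<subseteq> sets (pre_sigma (\<lambda>_. ennreal t))"
    using U(2) stopping_time_const by (rule mono_pre_sigma) simp
  then have "subalgebra (F (ennreal t)) (pre_sigma ?t)"
    using sets_pre_sigma_const by (auto simp: subalgebra_def space_F space_pre_sigma)
  then have "U ?t \<in> borel_measurable (F (ennreal t))" using U(1) by (rule measurable_from_subalg)
  then show ?thesis unfolding V_def by measurable
qed

lemma V_measurable: "V t \<in> borel_measurable M"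
  using subalgebra_F V_measurable_F by (rule measurable_from_subalg)

lemma integrable_V: "integrable Q (V t)"
proof -
  interpret Q: prob_space Q by (rule prob_space_Q)
  show ?thesis
    using abs_V_le borel_measurable_Q[OF V_measurable] by (intro Q.integrable_const_bound[of _ c]) auto
qed

lemma V_supermartingale:
  assumes "0 \<le> s" "s \<le> t"
  shows "AE \<omega> in Q. real_cond_exp Q (F (ennreal s)) (V t) \<omega> \<le> V s \<omega>"
proof -
  interpret Q: prob_space Q by (rule prob_space_Q)
  show ?thesis
  proof (rule Q.real_cond_exp_leI[OF subalgebra_Q[OF subalgebra_F] integrable_V integrable_V V_measurable_F])
    fix A assume A: "A \<in> sets (F (ennreal s))"
    have AQ[measurable]: "A \<in> sets Q" using A sets_F_subset by (auto simp: sets_Q)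
    have eq: "(\<integral>\<omega>. indicator A \<omega> * V r \<omega> \<partial>Q) = (\<integral>\<omega>. indicator A \<omega> * U (stopped (\<lambda>_. ennreal r)) \<omega> \<partial>Q)" for r
    proof (rule integral_cong_AE)
      have [measurable]: "V r \<in> borel_measurable Q" "U (stopped (\<lambda>_. ennreal r)) \<in> borel_measurable Q"
        using ordered_stopped[OF stopping_time_const, of "ennreal r"]
        by (auto intro!: borel_measurable_Q V_measurable Linfty_pre_sigma_measurable[OF _ U_L] dest: ordered_stop)
      show "(\<lambda>\<omega>. indicator A \<omega> * V r \<omega>) \<in> borel_measurable Q"
        "(\<lambda>\<omega>. indicator A \<omega> * U (stopped (\<lambda>_. ennreal r)) \<omega>) \<in> borel_measurable Q"
        by measurable
      show "AE \<omega> in Q. indicator A \<omega> * V r \<omega> = indicator A \<omega> * U (stopped (\<lambda>_. ennreal r)) \<omega>"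
        using AE_Q[OF AE_V_eq, of r] by eventually_elim simp
    qed
    show "(\<integral>\<omega>. indicator A \<omega> * V t \<omega> \<partial>Q) \<le> (\<integral>\<omega>. indicator A \<omega> * V s \<omega> \<partial>Q)"
      unfolding eq using assms(2) A by (intro integral_U_stopped_antimono ennreal_leI)
  qed
qed

text \<open>The count of moves is estimated under \<open>Q\<close>, where \<open>V\<close> is a
  supermartingale; equivalence transfers the result to \<open>M\<close>.\<close>

lemma AE_tame_V: "AE \<omega> in M. tame_on_dyadics (\<lambda>t. V t \<omega>)"
proof -
  interpret Q: prob_space Q by (rule prob_space_Q)
  have "AE \<omega> in Q. tame_on_dyadics (\<lambda>t. V t \<omega>)"
  proof (rule Q.AE_tame_on_dyadics[where G = "\<lambda>t. F (ennreal t)" and c = c])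
    show "sets (F (ennreal s)) \<subseteq> sets (F (ennreal t))" if "s \<le> t" for s t
      using that by (intro sets_F_mono ennreal_leI)
  qed (rule subalgebra_Q[OF subalgebra_F] V_measurable_F abs_V_le V_supermartingale; assumption?)+
  then show ?thesis by (rule AE_M)
qed

lemma right_limit_V_measurable:
  assumes "stopping_time F \<sigma>"
  shows "(\<lambda>\<omega>. right_limit (\<lambda>t. V t \<omega>) (enn2real (\<sigma> \<omega>))) \<in> borel_measurable M"
  unfolding right_limit_def
proof (rule borel_measurable_lim_metric)
  fix n
  have [measurable]: "\<sigma> \<in> borel_measurable M"
    using assms by (rule measurable_stopping_time) (auto simp: sets_F_subset[THEN subsetD] space_F)
  \<comment> \<open>For fixed \<open>n\<close> the random time takes countably many values, so
    \<open>V\<close> need only be measurable at each fixed time.\<close>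
  have "(\<lambda>\<omega>. \<lfloor>enn2real (\<sigma> \<omega>) * 2 ^ n\<rfloor>) \<in> M \<rightarrow>\<^sub>M count_space UNIV" by measurable
  then show "(\<lambda>\<omega>. V (dyadic_above n (enn2real (\<sigma> \<omega>))) \<omega>) \<in> borel_measurable M"
    unfolding dyadic_above_def
    by (rule measurable_compose_countable[where f = "\<lambda>i \<omega>. V ((of_int i + 1) / 2 ^ n) \<omega>", rotated])
      (rule V_measurable)
qed

text \<open>Along dyadic times above \<sigma> the variables \<open>U\<close> agree with
  \<open>V\<close> at the random time and converge on tame paths; \<open>U_eq_limit\<close>
  identifies the limit with \<open>U\<close> at the stopped time.\<close>

lemma AE_right_limit_V_eq:
  assumes \<sigma>: "stopping_time F \<sigma>" and fin: "\<And>\<omega>. \<omega> \<in> space M \<Longrightarrow> \<sigma> \<omega> < \<infinity>"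
  shows "AE \<omega> in M. right_limit (\<lambda>t. V t \<omega>) (enn2real (\<sigma> \<omega>)) = U (stopped \<sigma>) \<omega>"
proof -
  let ?\<tau> = "stopped \<sigma>" and ?\<tau>s = "\<lambda>n. stopped (dyadic_time n \<sigma>)"
  have dt: "stopping_time F (dyadic_time n \<sigma>)" for n
    using \<sigma> fin by (rule stopping_time_dyadic_time)
  have real: "\<sigma> \<omega> = ennreal (enn2real (\<sigma> \<omega>))" if "\<omega> \<in> space M" for \<omega>
    using fin[OF that] by simp
  have le: "\<sigma> \<omega> \<le> dyadic_time n \<sigma> \<omega>" if "\<omega> \<in> space M" for \<omega> n
    unfolding dyadic_time_def by (subst real[OF that]) (intro ennreal_leI less_imp_le dyadic_above_gt)
  have lim: "(\<lambda>n. dyadic_time n \<sigma> \<omega>) \<longlonglongrightarrow> \<sigma> \<omega>" if "\<omega> \<in> space M" for \<omega>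
    unfolding dyadic_time_def by (subst real[OF that]) (intro tendsto_ennrealI dyadic_above_tendsto)
  have dec: "dyadic_time m \<sigma> \<omega> \<le> dyadic_time n \<sigma> \<omega>" if "n \<le> m" for n m \<omega>
    unfolding dyadic_time_def
    using lift_Suc_antimono_le[of "\<lambda>n. dyadic_above n (enn2real (\<sigma> \<omega>))" n m] dyadic_above_Suc_le that
    by (intro ennreal_leI) auto
  have o: "ordered ?\<tau> (?\<tau>s n)" "ordered (?\<tau>s n) T" for n
    using \<sigma> dt le by (auto intro!: ordered_stopped_mono ordered_stopped)
  \<comment> \<open>Written through the \<open>U (?\<tau>s n)\<close>, the limit is measurable for
    \<open>pre_sigma ?\<tau>\<close>, as \<open>U_eq_limit\<close> requires.\<close>
  define l where "l \<omega> = lim (\<lambda>n. U (?\<tau>s n) \<omega>)" for \<omega>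
  have eq: "AE \<omega> in M. \<forall>n. V (dyadic_above n (enn2real (\<sigma> \<omega>))) \<omega> = U (?\<tau>s n) \<omega>"
  proof -
    \<comment> \<open>Null sets are discarded for the countably many possible values
      \<open>real (Suc i) / 2 ^ n\<close>; \<open>U_eq\<close> then compares each deterministic time
      with the random one where they coincide.\<close>
    have "AE \<omega> in M. \<forall>n i. V (real (Suc i) / 2 ^ n) \<omega> = U (stopped (\<lambda>_. ennreal (real (Suc i) / 2 ^ n))) \<omega>"
      unfolding AE_all_countable by (intro allI AE_V_eq)
    moreover have "AE \<omega> in M. \<forall>n i. min (ennreal (real (Suc i) / 2 ^ n)) (T \<omega>) = ?\<tau>s n \<omega> \<longrightarrow>
        U (stopped (\<lambda>_. ennreal (real (Suc i) / 2 ^ n))) \<omega> = U (?\<tau>s n) \<omega>"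
      unfolding AE_all_countable by (intro allI U_eq o ordered_stopped stopping_time_const)
    ultimately show ?thesis
    proof eventually_elim
      case (elim \<omega>)
      show ?case
      proof
        fix n
        obtain i where i: "dyadic_above n (enn2real (\<sigma> \<omega>)) = real (Suc i) / 2 ^ n"
          using dyadic_above_eq[OF enn2real_nonneg] by blast
        show "V (dyadic_above n (enn2real (\<sigma> \<omega>))) \<omega> = U (?\<tau>s n) \<omega>"
          using elim(1)[rule_format, of i n] elim(2)[rule_format, of i n] i by (simp add: dyadic_time_def)
      qed
    qed
  qed
  have conv: "AE \<omega> in M. (\<lambda>n. U (?\<tau>s n) \<omega>) \<longlonglongrightarrow> right_limit (\<lambda>t. V t \<omega>) (enn2real (\<sigma> \<omega>))"
    using eq AE_tame_V
  proof eventually_elim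
    case (elim \<omega>)
    then show ?case
      using filterlim_compose[OF tame_right_limit[OF elim(2) enn2real_nonneg] filterlim_dyadic_above[OF enn2real_nonneg], of "\<sigma> \<omega>"]
      by simp
  qed
  then have l_eq: "AE \<omega> in M. l \<omega> = right_limit (\<lambda>t. V t \<omega>) (enn2real (\<sigma> \<omega>))"
    by eventually_elim (simp add: l_def limI)
  have l_lim: "AE \<omega> in M. (\<lambda>n. U (?\<tau>s n) \<omega>) \<longlonglongrightarrow> l \<omega>"
    using conv l_eq by eventually_elim simp
  have "AE \<omega> in M. \<forall>n. \<bar>U (?\<tau>s n) \<omega>\<bar> \<le> c"
    unfolding AE_all_countable by (intro allI rho_bound[OF o(2) X X_bound])
  with l_lim have "AE \<omega> in M. \<bar>l \<omega>\<bar> \<le> c"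
    by eventually_elim (auto intro: LIMSEQ_le_const2[OF tendsto_rabs])
  moreover have "l \<in> borel_measurable (pre_sigma ?\<tau>)"
    unfolding l_def
  proof (rule borel_measurable_lim_pre_sigma)
    show "stopping_time F ?\<tau>" "stopping_time F (?\<tau>s n)" for n
      using ordered_stop[OF o(1)] by auto
    show "(\<lambda>n. ?\<tau>s n \<omega>) \<longlonglongrightarrow> ?\<tau> \<omega>" if "\<omega> \<in> space M" for \<omega>
      by (intro tendsto_min lim[OF that] tendsto_const)
    show "?\<tau> \<omega> \<le> ?\<tau>s n \<omega>" if "\<omega> \<in> space M" for \<omega> n
      using le[OF that] by (intro min.mono) auto
    show "?\<tau>s m \<omega> \<le> ?\<tau>s n \<omega>" if "n \<le> m" for \<omega> n m
      using dec[OF that] by (intro min.mono) auto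
    show "U (?\<tau>s n) \<in> borel_measurable (pre_sigma (?\<tau>s n))" for n
      using U_L[OF o(2)] by (simp add: Linfty_def)
  qed
  ultimately have "l \<in> L ?\<tau>" by (auto simp: Linfty_def)
  with o l_lim have "AE \<omega> in M. U ?\<tau> \<omega> = l \<omega>" by (intro U_eq_limit)
  with l_eq show ?thesis by eventually_elim simp
qed

lemma cadlag_version_exists:
  "\<exists>Y :: real \<Rightarrow> 'a \<Rightarrow> real. supermartingale Q F Y \<and> (\<forall>\<omega>\<in>space M. cadlag (\<lambda>t. Y t \<omega>)) \<and>
     (\<forall>\<sigma>. stopping_time F \<sigma> \<longrightarrow> (\<forall>\<omega>\<in>space M. \<sigma> \<omega> \<le> T \<omega> \<and> \<sigma> \<omega> < \<infinity>) \<longrightarrow>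
        (\<lambda>\<omega>. Y (enn2real (\<sigma> \<omega>)) \<omega>) \<in> L \<sigma> \<and> (AE \<omega> in M. U \<sigma> \<omega> = Y (enn2real (\<sigma> \<omega>)) \<omega>))"
proof -
  interpret Q: prob_space Q by (rule prob_space_Q)
  obtain N where N: "N \<in> null_sets M" "\<And>\<omega>. \<omega> \<in> space M - N \<Longrightarrow> tame_on_dyadics (\<lambda>t. V t \<omega>)"
    using AE_E3[OF AE_tame_V] by blast
  \<comment> \<open>Zero on the exceptional set makes every path cadlag; since null sets lie in each
    \<open>F t\<close>, this keeps the process adapted.\<close>
  define Y where "Y t \<omega> = (if \<omega> \<in> N then 0 else right_limit (\<lambda>t. V t \<omega>) t)" for t \<omega>
  have Y_meas: "(\<lambda>\<omega>. Y (enn2real (\<sigma> \<omega>)) \<omega>) \<in> borel_measurable M" if "stopping_time F \<sigma>" for \<sigma>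
    using right_limit_V_measurable[OF that] N(1) unfolding Y_def
    by (intro measurable_If_set) auto
  have Y_eq: "AE \<omega> in M. Y (enn2real (\<sigma> \<omega>)) \<omega> = U (stopped \<sigma>) \<omega>"
    if "stopping_time F \<sigma>" "\<And>\<omega>. \<omega> \<in> space M \<Longrightarrow> \<sigma> \<omega> < \<infinity>" for \<sigma>
  proof -
    have "AE \<omega> in M. right_limit (\<lambda>t. V t \<omega>) (enn2real (\<sigma> \<omega>)) = U (stopped \<sigma>) \<omega>"
      using that by (rule AE_right_limit_V_eq)
    with AE_not_in[OF N(1)] show ?thesis by eventually_elim (auto simp: Y_def)
  qed
  \<comment> \<open>At a constant time the identification of the right limit says that
    \<open>Y\<close> is a modification of \<open>V\<close>, so it inherits the supermartingale
    inequality.\<close>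
  have Y_V: "AE \<omega> in M. Y t \<omega> = V t \<omega>" and Y_meas_M: "Y t \<in> borel_measurable M" if "0 \<le> t" for t
    using Y_eq[OF stopping_time_const, of "ennreal t"] AE_V_eq[of t] Y_meas[OF stopping_time_const, of "ennreal t"] that
    by auto
  have Y_F: "Y t \<in> borel_measurable (F (ennreal t))" if "0 \<le> t" for t
    by (rule borel_measurable_AE_eq[OF subalgebra_F _ Y_meas_M[OF that] V_measurable_F Y_V[OF that]])
      (auto intro: null_sets_F)
  have Y_Q: "Y t \<in> borel_measurable Q" if "0 \<le> t" for t
    using Y_meas_M[OF that] by (rule borel_measurable_Q)
  have V_Q: "V t \<in> borel_measurable Q" for t by (rule borel_measurable_Q[OF V_measurable])
  have "supermartingale Q F Y"
    unfolding supermartingale_def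
  proof (intro conjI allI impI)
    fix t :: real assume t: "0 \<le> t"
    show "Y t \<in> borel_measurable (F (ennreal t))" using t by (rule Y_F)
    show "integrable Q (Y t)"
      using integrable_V[of t] integrable_cong_AE[OF Y_Q[OF t] V_Q AE_Q[OF Y_V[OF t]]] by simp
  next
    fix s t :: real assume st: "0 \<le> s" "s \<le> t"
    then have t: "0 \<le> t" by simp
    interpret finite_measure_subalgebra Q "F (ennreal s)"
      by unfold_locales (rule subalgebra_Q[OF subalgebra_F])
    show "AE \<omega> in Q. real_cond_exp Q (F (ennreal s)) (Y t) \<omega> \<le> Y s \<omega>"
      using real_cond_exp_cong[OF AE_Q[OF Y_V[OF t]] Y_Q[OF t] V_Q] V_supermartingale[OF st]
        AE_Q[OF Y_V[OF st(1)]]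
      by eventually_elim simp
  qed
  moreover have "cadlag (\<lambda>t. Y t \<omega>)" if "\<omega> \<in> space M" for \<omega>
  proof (cases "\<omega> \<in> N")
    case True
    then show ?thesis by (auto simp: Y_def cadlag_def)
  next
    case False
    then have "(\<lambda>t. Y t \<omega>) = right_limit (\<lambda>t. V t \<omega>)" by (auto simp: Y_def)
    then show ?thesis using cadlag_right_limit[OF N(2)] that False by simp
  qed
  moreover have "(\<lambda>\<omega>. Y (enn2real (\<sigma> \<omega>)) \<omega>) \<in> L \<sigma> \<and> (AE \<omega> in M. U \<sigma> \<omega> = Y (enn2real (\<sigma> \<omega>)) \<omega>)"
    if \<sigma>: "stopping_time F \<sigma>" "\<forall>\<omega>\<in>space M. \<sigma> \<omega> \<le> T \<omega> \<and> \<sigma> \<omega> < \<infinity>" for \<sigma>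
  proof -
    have o: "ordered \<sigma> T" using \<sigma> T by (simp add: ordered_stopping_times_def)
    \<comment> \<open>Stopping at \<open>T\<close> does not affect a time bounded by
      \<open>T\<close>.\<close>
    have "AE \<omega> in M. stopped \<sigma> \<omega> = \<sigma> \<omega>"
      using AE_space by eventually_elim (use \<sigma>(2) in \<open>auto simp: min_absorb1\<close>)
    with U_eq[OF ordered_stopped[OF \<sigma>(1)] o] Y_eq[OF \<sigma>(1)] \<sigma>(2)
    have eq: "AE \<omega> in M. Y (enn2real (\<sigma> \<omega>)) \<omega> = U \<sigma> \<omega>" by auto
    have "U \<sigma> \<in> borel_measurable (pre_sigma \<sigma>)" using U_L[OF o] by (simp add: Linfty_def)
    from borel_measurable_AE_eq[OF subalgebra_pre_sigma[OF \<sigma>(1)] null_sets_pre_sigma[OF \<sigma>(1)] Y_meas[OF \<sigma>(1)] this eq]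
    have "(\<lambda>\<omega>. Y (enn2real (\<sigma> \<omega>)) \<omega>) \<in> borel_measurable (pre_sigma \<sigma>)" .
    moreover have "AE \<omega> in M. \<bar>Y (enn2real (\<sigma> \<omega>)) \<omega>\<bar> \<le> c"
      using eq rho_bound[OF o X X_bound] by eventually_elim simp
    ultimately show ?thesis using eq by (auto simp: Linfty_def)
  qed
  ultimately show ?thesis by blast
qed

end

theorem theorem2p3:
  fixes M :: "'a measure" and F :: "ennreal \<Rightarrow> 'a measure"
    and \<rho> :: "('a \<Rightarrow> ennreal) \<Rightarrow> ('a \<Rightarrow> ennreal) \<Rightarrow> ('a \<Rightarrow> real) \<Rightarrow> 'a \<Rightarrow> real"
    and T :: "'a \<Rightarrow> ennreal" and Q :: "'a measure" and X :: "'a \<Rightarrow> real"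
  assumes "filtered_prob_space M F"
    and "dynamic_risk_measure M F \<rho>"
    and "normalized M F \<rho>"
    and "continuous_from_above M F \<rho>"
    and "time_consistent M F \<rho>"
    and "stopping_time F T"
    and "Q \<in> zero_penalty_measures M F \<rho> T"
    and "absolutely_continuous Q M"
    and "X \<in> Linfty M (stopped_algebra M F T)"
  shows "\<exists>Y :: real \<Rightarrow> 'a \<Rightarrow> real.
           supermartingale Q F Y \<and>
           (\<forall>\<omega>\<in>space M. cadlag (\<lambda>t. Y t \<omega>)) \<and>
           (\<forall>\<sigma>. stopping_time F \<sigma> \<longrightarrow> (\<forall>\<omega>\<in>space M. \<sigma> \<omega> \<le> T \<omega> \<and> \<sigma> \<omega> < \<infinity>) \<longrightarrow>
              (\<lambda>\<omega>. Y (enn2real (\<sigma> \<omega>)) \<omega>) \<in> Linfty M (stopped_algebra M F \<sigma>) \<and>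
              (AE \<omega> in M. \<rho> \<sigma> T X \<omega> = Y (enn2real (\<sigma> \<omega>)) \<omega>))"
proof -
  obtain b where "AE \<omega> in M. \<bar>X \<omega>\<bar> \<le> b" using assms(9) by (auto simp: Linfty_def)
  then have "AE \<omega> in M. \<bar>X \<omega>\<bar> \<le> \<bar>b\<bar>" by eventually_elim simp
  with assms interpret zero_penalty_risk M F \<rho> T Q X "\<bar>b\<bar>"
    unfolding zero_penalty_risk_def zero_penalty_risk_axioms_def by simp
  show ?thesis by (rule cadlag_version_exists)
qed

end
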